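(* Let $p\in[2,\infty]$, let $f\in\mathscr{A}(\mathbb{D})$, and suppose that both $\omega$ and $\omega^2$ are regular majorants. Then $f\in\Lambda_{\omega,p}(\overline{\mathbb{D}})$ if and only if there is a constant $M>0$ such that for all $z\in\mathbb{D}$: $$\left(\int_0^{2\pi}\left(P[|f|^2](ze^{i\eta})-|f(ze^{i\eta})|^2\right)^{p/2}d\eta\right)^{1/p}\le M\omega(d_{\mathbb{D}}(z))\quad\text{if } p\in[2,\infty),$$ $$\left(P[|f|^2](z)-|f(z)|^2\right)^{1/2}\le M\omega(d_{\mathbb{D}}(z))\quad\text{if } p=\infty.$$
   Context: $\mathbb{D}$ is the open unit disk in $\mathbb{C}$, $\mathbb{T}=\partial\mathbb{D}$, $d_{\mathbb{D}}(z)=1-|z|$. $\mathscr{A}(\mathbb{D})$ is the disk algebra: functions analytic in $\mathbb{D}$ and continuous up to the boundary. A majorant is a continuous increasing function $\omega:[0,\infty)\to[0,\infty)$ with $\omega(0)=0$ such that $\omega(t)/t$ is non-increasing for $t>0$. It is regular if, for some $\delta_0>0$ and $M>0$, both $\int_0^\delta\frac{\omega(t)}{t}\,dt\le M\omega(\delta)$ and $\delta\int_\delta^\infty\frac{\omega(t)}{t^2}\,dt\le M\omega(\delta)$ hold for all $0<\delta<\delta_0$. Here $\omega^2(t)=(\omega(t))^2$. For $p\in(0,\infty)$ put $\mathcal{L}_p[F](z_1,z_2)=\left(\int_0^{2\pi}|F(e^{i\eta}z_1)-F(e^{i\eta}z_2)|^p\,d\eta\right)^{1/p}$, and $\mathcal{L}_\infty[F](z_1,z_2)=|F(z_1)-F(z_2)|$.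 $\Lambda_{\omega,p}(\overline{\mathbb{D}})$ is the class of Borel functions $F:\overline{\mathbb{D}}\to\mathbb{C}$ for which there is $M>0$ with $\mathcal{L}_p[F](z_1,z_2)\le M\omega(|z_1-z_2|)$ for all $z_1,z_2\in\overline{\mathbb{D}}$. $P[\varphi](z)=\frac1{2\pi}\int_0^{2\pi}\varphi(e^{i\tau})\frac{1-|z|^2}{|e^{i\tau}-z|^2}\,d\tau$ is the Poisson integral, and $P[|f|^2]$ denotes the Poisson integral of the boundary function of $|f|^2$. *)

theory Defs
  imports "HOL-Analysis.Analysis"
begin

text \<open>
  A majorant is a function on \<open>[0,\<infinity>)\<close>, encoded as a total function \<^typ>\<open>real \<Rightarrow> real\<close> whose values at
  negative arguments are irrelevant. ``Increasing'' is read in the wide sense (non-decreasing).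
\<close>

definition majorant :: "(real \<Rightarrow> real) \<Rightarrow> bool" where
  "majorant \<omega> \<longleftrightarrow>
     continuous_on {0..} \<omega> \<and> (\<forall>t\<ge>0. \<omega> t \<ge> 0) \<and> mono_on {0..} \<omega> \<and> \<omega> 0 = 0 \<and>
     antimono_on {0<..} (\<lambda>t. \<omega> t / t)"

text \<open>
  The two integrals are taken with values in \<open>[0,\<infinity>]\<close>, so that a divergent integral
  violates the bound.
\<close>

definition regular_majorant :: "(real \<Rightarrow> real) \<Rightarrow> bool" where
  "regular_majorant \<omega> \<longleftrightarrow> majorant \<omega> \<and>
     (\<exists>\<delta>\<^sub>0>0. \<exists>M>0. \<forall>\<delta>. 0 < \<delta> \<and> \<delta> < \<delta>\<^sub>0 \<longrightarrow>
        (\<integral>\<^sup>+t\<in>{0<..<\<delta>}. ennreal (\<omega> t / t) \<partial>lborel) \<le> ennreal (M * \<omega> \<delta>) \<and>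
        ennreal \<delta> * (\<integral>\<^sup>+t\<in>{\<delta><..}. ennreal (\<omega> t / t\<^sup>2) \<partial>lborel) \<le> ennreal (M * \<omega> \<delta>))"

definition disk_algebra :: "(complex \<Rightarrow> complex) set" where
  "disk_algebra = {f. f analytic_on ball 0 1 \<and> continuous_on (cball 0 1) f}"

definition disk_dist :: "complex \<Rightarrow> real" where
  "disk_dist z = 1 - cmod z"

text \<open>Powers on \<open>[0,\<infinity>]\<close>, meant for exponents \<open>a > 0\<close> only.\<close>

definition ennreal_powr :: "ennreal \<Rightarrow> real \<Rightarrow> ennreal" where
  "ennreal_powr x a = (if x = \<infinity> then \<infinity> else ennreal (enn2real x powr a))"

text \<open>
  The integral means \<open>\<L>\<^sub>p[F](z\<^sub>1,z\<^sub>2)\<close> for \<open>p \<in> (0,\<infinity>]\<close>; they may be infinite, as a Borel function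
  \<open>F\<close> need not be integrable on circles.
\<close>

definition int_mean_diff ::
    "ennreal \<Rightarrow> (complex \<Rightarrow> complex) \<Rightarrow> complex \<Rightarrow> complex \<Rightarrow> ennreal" where
  "int_mean_diff p F z\<^sub>1 z\<^sub>2 =
     (if p = \<infinity> then ennreal (cmod (F z\<^sub>1 - F z\<^sub>2))
      else ennreal_powr
        (\<integral>\<^sup>+\<eta>\<in>{0..2*pi}. ennreal (cmod (F (cis \<eta> * z\<^sub>1) - F (cis \<eta> * z\<^sub>2)) powr enn2real p) \<partial>lborel)
        (1 / enn2real p))"

definition Lambda_class :: "(real \<Rightarrow> real) \<Rightarrow> ennreal \<Rightarrow> (complex \<Rightarrow> complex) set" where
  "Lambda_class \<omega> p =
     {F. F \<in> borel_measurable (restrict_space borel (cball 0 1)) \<and>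
         (\<exists>M>0. \<forall>z\<^sub>1\<in>cball 0 1. \<forall>z\<^sub>2\<in>cball 0 1.
            int_mean_diff p F z\<^sub>1 z\<^sub>2 \<le> ennreal (M * \<omega> (cmod (z\<^sub>1 - z\<^sub>2))))}"

text \<open>Only the values of \<open>\<phi>\<close> on the unit circle matter.\<close>

definition poisson_integral :: "(complex \<Rightarrow> real) \<Rightarrow> complex \<Rightarrow> real" where
  "poisson_integral \<phi> z =
     1 / (2*pi) * (LINT \<tau>:{0..2*pi}|lborel. \<phi> (cis \<tau>) * ((1 - (cmod z)\<^sup>2) / (cmod (cis \<tau> - z))\<^sup>2))"

end

theory Submission
  imports Defs "HOL-Complex_Analysis.Cauchy_Integral_Formula"
begin

text \<open>
  For \<open>f\<close> in the disk algebra the quantity \<open>P[|f|\<^sup>2](z) - |f(z)|\<^sup>2\<close> is a variance: since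
  \<open>P[f](z) = f(z)\<close>, it equals the mean of \<open>|f(\<zeta>) - f(z)|\<^sup>2\<close> over the unit circle against the Poisson
  kernel at \<open>z\<close> (\<open>poisson_variance_eq\<close>). So both sides of the equivalence compare values of \<open>f\<close>,
  and the two regularity conditions convert one comparison into the other.

  From \<open>\<Lambda>\<^bsub>\<omega>,p\<^esub>\<close> to the variance: write \<open>z = r u\<close> with \<open>|u| = 1\<close> and rotate the circle, so that
  the variance at \<open>e\<^sup>i\<^sup>\<eta> z\<close> is an average over \<open>\<tau>\<close>, with weights that do not depend on \<open>\<eta>\<close>, of
  \<open>|f(e\<^sup>i\<^sup>\<eta> e\<^sup>i\<^sup>\<tau> u) - f(e\<^sup>i\<^sup>\<eta> z)|\<^sup>2\<close>. As \<open>p / 2 \<ge> 1\<close>, Minkowski's integral inequality bounds the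
  \<open>L\<^bsup>p/2\<^esup>\<close> mean in \<open>\<eta>\<close> by the same average of \<open>\<omega>\<^sup>2(|e\<^sup>i\<^sup>\<tau> - r|)\<close>. The tail condition on \<open>\<omega>\<^sup>2\<close>
  makes this average \<open>O(\<omega>\<^sup>2(1 - r))\<close> (\<open>regular_majorant_poisson_integral\<close>).

  From the variance to \<open>\<Lambda>\<^bsub>\<omega>,p\<^esub>\<close>: the Cauchy formula for \<open>f'\<close> and the Cauchy-Schwarz inequality show that
  \<open>(1 - |z|\<^sup>2) |f'(z)|\<close> is at most the root of the variance
  (\<open>norm_deriv_le_poisson_variance\<close>), hence the \<open>L\<^sup>p\<close> mean of \<open>f'\<close> over the circle of radius \<open>|z|\<close> is
  \<open>O(\<omega>(1 - |z|) / (1 - |z|))\<close>. Now integrate \<open>f'\<close> as Hardy and Littlewood do: with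
  \<open>d = min 1 |z\<^sub>1 - z\<^sub>2|\<close> go from \<open>z\<^sub>1\<close> radially to \<open>(1 - d) z\<^sub>1\<close>, straight to \<open>(1 - d) z\<^sub>2\<close>, and radially
  to \<open>z\<^sub>2\<close>. The radial parts cost \<open>\<integral>\<^sub>0\<^sup>d \<omega>(t)/t dt = O(\<omega>(d))\<close>, which is the condition on \<open>\<omega>\<close> near \<open>0\<close>;
  the middle part has length at most \<open>d\<close> and stays at distance at least \<open>d\<close> from the circle.
  Minkowski's integral inequality again moves the \<open>L\<^sup>p\<close> mean inside the path integrals.

  Finite \<open>p\<close> and \<open>p = \<infinity>\<close> are treated together through the predicate \<open>mean_le\<close>.
\<close>

section \<open>Minkowski's integral inequality\<close>

text \<open>
  The graph of \<open>a \<mapsto> a\<^sup>q\<close> lies above its tangent at \<open>c\<close>.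
\<close>

lemma powr_tangent_bound:
  fixes a c q :: real
  assumes "1 \<le> q" "0 \<le> a" "0 < c"
  shows "q * c powr (q - 1) * a \<le> a powr q + (q - 1) * c powr q"
proof (cases "q = 1")
  case False
  then have q: "q > 1" using assms by simp
  have "a * c powr (q - 1) \<le> a powr q / q + (c powr (q - 1)) powr (q / (q - 1)) / (q / (q - 1))"
    by (rule Youngs_inequality) (use q assms in \<open>auto simp: field_simps\<close>)
  also have "(c powr (q - 1)) powr (q / (q - 1)) = c powr q"
    using q by (simp add: powr_powr)
  finally show ?thesis
    using q by (simp add: field_simps)
qed (use assms in auto)

text \<open>
  Jensen's inequality for the power \<open>q\<close>, the ratio \<open>h / b\<close> and the measure with density \<open>b\<close>, obtained by
  integrating the tangent bound at \<open>c = G / B\<close>. The tangent makes the integrability questions of the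
  usual proof disappear, as every term is nonnegative.
\<close>

lemma powr_nn_integral_le_weighted:
  fixes h b :: "'a \<Rightarrow> real"
  assumes q: "1 \<le> q" and [measurable]: "h \<in> borel_measurable M" "b \<in> borel_measurable M"
    and h: "\<And>s. 0 \<le> h s" and b: "\<And>s. s \<in> space M \<Longrightarrow> 0 < b s"
    and B: "(\<integral>\<^sup>+s. ennreal (b s) \<partial>M) \<le> ennreal B" "0 < B"
    and G: "0 \<le> G" "ennreal G \<le> (\<integral>\<^sup>+s. ennreal (h s) \<partial>M)"
  shows "ennreal (G powr q) \<le>
    ennreal (B powr (q - 1)) * (\<integral>\<^sup>+s. ennreal (h s powr q * b s powr (1 - q)) \<partial>M)"
proof (cases "G = 0")
  case False
  \<comment> \<open>For this \<open>c\<close> the bounds \<open>q c\<^bsup>q-1\<^esup> G\<close> and \<open>(q - 1) c\<^sup>q B\<close> differ by exactly \<open>c\<^sup>q B\<close>.\<close>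
  define c where "c = G / B"
  have c: "c > 0" using False G B by (simp add: c_def)
  define H where "H = (\<integral>\<^sup>+s. ennreal (h s powr q * b s powr (1 - q)) \<partial>M)"
  have pt: "q * c powr (q - 1) * h s \<le> h s powr q * b s powr (1 - q) + (q - 1) * c powr q * b s"
    if "s \<in> space M" for s
  proof -
    note b' = b[OF that]
    have "q * c powr (q - 1) * (h s / b s) * b s \<le> ((h s / b s) powr q + (q - 1) * c powr q) * b s"
      using powr_tangent_bound[OF q, of "h s / b s" c] h[of s] b' c
      by (intro mult_right_mono) auto
    moreover have "(h s / b s) powr q * b s = h s powr q * b s powr (1 - q)"
      using h[of s] b' by (simp add: powr_divide powr_diff)
    ultimately show ?thesis using b' by (simp add: algebra_simps)
  qed
  have "ennreal (q * c powr (q - 1)) * ennreal G \<le> ennreal (q * c powr (q - 1)) * (\<integral>\<^sup>+s. ennreal (h s) \<partial>M)"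
    using G by (intro mult_left_mono) auto
  also have "\<dots> = (\<integral>\<^sup>+s. ennreal (q * c powr (q - 1) * h s) \<partial>M)"
    using q h by (subst nn_integral_cmult[symmetric]) (auto simp: ennreal_mult[symmetric])
  also have "\<dots> \<le> (\<integral>\<^sup>+s. ennreal (h s powr q * b s powr (1 - q)) + ennreal ((q - 1) * c powr q) * ennreal (b s) \<partial>M)"
    using q b by (intro nn_integral_mono)
      (auto simp: ennreal_mult[symmetric] ennreal_plus[symmetric] less_imp_le simp del: ennreal_plus intro!: pt ennreal_leI)
  also have "\<dots> = H + ennreal ((q - 1) * c powr q) * (\<integral>\<^sup>+s. ennreal (b s) \<partial>M)"
    unfolding H_def by (subst nn_integral_add) (auto simp: nn_integral_cmult)
  also have "\<dots> \<le> H + ennreal ((q - 1) * c powr q) * ennreal B"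
    using B by (intro add_left_mono mult_left_mono) auto
  finally have main: "ennreal (q * c powr (q - 1) * G) \<le> H + ennreal ((q - 1) * c powr q * B)"
    using q B G by (simp add: ennreal_mult)
  show ?thesis
  proof (cases H)
    case (real r)
    have "q * c powr (q - 1) * G \<le> r + (q - 1) * c powr q * B"
      using main real q B by (simp add: ennreal_plus[symmetric] del: ennreal_plus)
    moreover have "c powr (q - 1) * G = c powr q * B"
      using c B False G by (simp add: powr_diff c_def)
    ultimately have "q * (c powr q * B) \<le> r + (q - 1) * c powr q * B" by (simp only: mult.assoc)
    then have "c powr q * B \<le> r" by (simp add: algebra_simps)
    then have "B powr (q - 1) * (c powr q * B) \<le> B powr (q - 1) * r"
      by (intro mult_left_mono) auto
    moreover have "B powr (q - 1) * (c powr q * B) = G powr q"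
      using B G by (simp add: c_def powr_divide powr_diff)
    ultimately show ?thesis using real B unfolding H_def[symmetric]
      by (simp add: ennreal_mult[symmetric] ennreal_leI)
  next
    case top
    then show ?thesis unfolding H_def[symmetric] using B by (simp add: ennreal_mult_top)
  qed
qed simp

text \<open>
  Raising \<open>G x\<close> to the power \<open>q\<close> by the weighted Jensen inequality leaves an integral that is linear
  in \<open>h\<^sup>q\<close>, so the order of integration can be exchanged; the weight \<open>b\<^bsup>1-q\<^esup>\<close> then turns the bound
  \<open>b\<^sup>q\<close> into \<open>b\<close>.
\<close>

lemma Minkowski_positive_bounds:
  fixes h :: "'a \<Rightarrow> 'b \<Rightarrow> real"
  assumes "sigma_finite_measure M" "sigma_finite_measure N" and q: "1 \<le> q"
    and hm[measurable]: "(\<lambda>(s, x). h s x) \<in> borel_measurable (M \<Otimes>\<^sub>M N)"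
    and [measurable]: "b \<in> borel_measurable M"
    and h: "\<And>s x. 0 \<le> h s x" and b: "\<And>s. s \<in> space M \<Longrightarrow> 0 < b s"
    and hb: "\<And>s. s \<in> space M \<Longrightarrow> (\<integral>\<^sup>+x. ennreal (h s x powr q) \<partial>N) \<le> ennreal (b s powr q)"
    and B: "(\<integral>\<^sup>+s. ennreal (b s) \<partial>M) \<le> ennreal B" "0 < B"
    and G: "\<And>x. 0 \<le> G x"
      "\<And>x. x \<in> space N \<Longrightarrow> ennreal (G x) \<le> (\<integral>\<^sup>+s. ennreal (h s x) \<partial>M)"
  shows "(\<integral>\<^sup>+x. ennreal (G x powr q) \<partial>N) \<le> ennreal (B powr q)"
proof -
  interpret M: sigma_finite_measure M by fact
  interpret N: sigma_finite_measure N by fact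
  interpret pair_sigma_finite M N ..
  have [measurable]: "(\<lambda>s. h s x) \<in> borel_measurable M" if "x \<in> space N" for x
    using measurable_Pair1[OF hm that] by simp
  have [measurable]: "(\<lambda>x. h s x) \<in> borel_measurable N" if "s \<in> space M" for s
    using measurable_Pair2[OF hm that] by simp
  have m[measurable]: "(\<lambda>(s, x). ennreal (h s x powr q * b s powr (1 - q))) \<in> borel_measurable (M \<Otimes>\<^sub>M N)"
    by measurable
  have "(\<integral>\<^sup>+x. ennreal (G x powr q) \<partial>N)
      \<le> (\<integral>\<^sup>+x. ennreal (B powr (q - 1)) * (\<integral>\<^sup>+s. ennreal (h s x powr q * b s powr (1 - q)) \<partial>M) \<partial>N)"
    by (intro nn_integral_mono powr_nn_integral_le_weighted) (use assms in auto)
  also have "\<dots> = ennreal (B powr (q - 1)) * (\<integral>\<^sup>+x. (\<integral>\<^sup>+s. ennreal (h s x powr q * b s powr (1 - q)) \<partial>M) \<partial>N)"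
    by (rule nn_integral_cmult) measurable
  also have "(\<integral>\<^sup>+x. (\<integral>\<^sup>+s. ennreal (h s x powr q * b s powr (1 - q)) \<partial>M) \<partial>N)
      = (\<integral>\<^sup>+s. (\<integral>\<^sup>+x. ennreal (h s x powr q * b s powr (1 - q)) \<partial>N) \<partial>M)"
    using Fubini'[OF m] by simp
  also have "\<dots> \<le> (\<integral>\<^sup>+s. ennreal (b s) \<partial>M)"
  proof (rule nn_integral_mono)
    fix s assume s: "s \<in> space M"
    have "(\<integral>\<^sup>+x. ennreal (h s x powr q * b s powr (1 - q)) \<partial>N) =
       (\<integral>\<^sup>+x. ennreal (h s x powr q) \<partial>N) * ennreal (b s powr (1 - q))"
      using s by (subst nn_integral_multc[symmetric]) (auto simp: ennreal_mult)
    also have "\<dots> \<le> ennreal (b s powr q) * ennreal (b s powr (1 - q))"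
      by (intro mult_right_mono hb s) auto
    also have "\<dots> = ennreal (b s)"
      using b[OF s] by (simp add: ennreal_mult[symmetric] powr_add[symmetric])
    finally show "(\<integral>\<^sup>+x. ennreal (h s x powr q * b s powr (1 - q)) \<partial>N) \<le> ennreal (b s)" .
  qed
  also have "\<dots> \<le> ennreal B" by (rule B)
  finally have "(\<integral>\<^sup>+x. ennreal (G x powr q) \<partial>N) \<le> ennreal (B powr (q - 1)) * ennreal B"
    by (simp add: mult_left_mono)
  also have "\<dots> = ennreal (B powr q)"
    using B by (simp add: ennreal_mult[symmetric] powr_diff)
  finally show ?thesis .
qed

text \<open>
  Stated through bounds: if each slice \<open>h s\<close> has \<open>L\<^sup>q\<close> norm at most \<open>b s\<close>, then the integral over \<open>s\<close>
  has \<open>L\<^sup>q\<close> norm at most the integral of \<open>b\<close>. Zeros of \<open>b\<close> are removed by adding a small multiple of a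
  positive integrable function, which exists on every \<open>\<sigma>\<close>-finite space.
\<close>

theorem Minkowski_integral_inequality:
  fixes h :: "'a \<Rightarrow> 'b \<Rightarrow> real"
  assumes M: "sigma_finite_measure M" and N: "sigma_finite_measure N" and q: "1 \<le> q"
    and hm: "(\<lambda>(s, x). h s x) \<in> borel_measurable (M \<Otimes>\<^sub>M N)"
    and [measurable]: "b \<in> borel_measurable M"
    and h: "\<And>s x. 0 \<le> h s x" and b: "\<And>s. 0 \<le> b s"
    and hb: "\<And>s. s \<in> space M \<Longrightarrow> (\<integral>\<^sup>+x. ennreal (h s x powr q) \<partial>N) \<le> ennreal (b s powr q)"
    and B: "(\<integral>\<^sup>+s. ennreal (b s) \<partial>M) \<le> ennreal B" "0 \<le> B"
    and G: "\<And>x. 0 \<le> G x"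
      "\<And>x. x \<in> space N \<Longrightarrow> ennreal (G x) \<le> (\<integral>\<^sup>+s. ennreal (h s x) \<partial>M)"
  shows "(\<integral>\<^sup>+x. ennreal (G x powr q) \<partial>N) \<le> ennreal (B powr q)"
proof -
  obtain k :: "'a \<Rightarrow> real" where k: "integrable M k" "\<And>s. 0 < k s"
    using sigma_finite_measure.obtain_positive_integrable_function[OF M] by metis
  then have [measurable]: "k \<in> borel_measurable M" by auto
  define K where "K = integral\<^sup>L M k + 1"
  have "0 \<le> integral\<^sup>L M k" using k by (intro integral_nonneg_AE) (auto simp: less_imp_le)
  then have K: "K > 0" by (simp add: K_def)
  have kK: "(\<integral>\<^sup>+s. ennreal (k s) \<partial>M) \<le> ennreal K"
    using k by (subst nn_integral_eq_integral) (auto simp: K_def less_imp_le)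
  have bound: "(\<integral>\<^sup>+x. ennreal (G x powr q) \<partial>N) \<le> ennreal ((B + e * K) powr q)" if "e > 0" for e
  proof (rule Minkowski_positive_bounds[OF M N q hm, where b = "\<lambda>s. b s + e * k s"])
    show "0 < b s + e * k s" for s
      using k(2)[of s] b[of s] that by (simp add: add_nonneg_pos)
    have "(\<integral>\<^sup>+s. ennreal (b s + e * k s) \<partial>M) = (\<integral>\<^sup>+s. ennreal (b s) \<partial>M) + ennreal e * (\<integral>\<^sup>+s. ennreal (k s) \<partial>M)"
      using that k b by (subst nn_integral_cmult[symmetric], simp, subst nn_integral_add[symmetric])
        (auto simp: ennreal_plus ennreal_mult less_imp_le)
    also have "\<dots> \<le> ennreal B + ennreal e * ennreal K"
      by (intro add_mono mult_left_mono B kK) auto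
    also have "\<dots> = ennreal (B + e * K)"
      using that B K by (simp add: ennreal_plus ennreal_mult)
    finally show "(\<integral>\<^sup>+s. ennreal (b s + e * k s) \<partial>M) \<le> ennreal (B + e * K)" .
    show "0 < B + e * K" using B K that by (simp add: add_nonneg_pos)
    show "(\<integral>\<^sup>+x. ennreal (h s x powr q) \<partial>N) \<le> ennreal ((b s + e * k s) powr q)" if "s \<in> space M" for s
      using hb[OF that] by (rule order_trans)
       (use q b[of s] k(2)[of s] \<open>e > 0\<close> in \<open>auto intro!: ennreal_leI powr_mono2 simp: less_imp_le\<close>)
  qed (use h G in auto)
  have "((\<lambda>e. ennreal ((B + e * K) powr q)) \<longlongrightarrow> ennreal ((B + 0 * K) powr q)) (at_right 0)"
    using q B K by (intro tendsto_ennrealI tendsto_powr' tendsto_intros)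
      (auto simp: eventually_at_filter)
  moreover have "\<forall>\<^sub>F e in at_right 0. (\<integral>\<^sup>+x. ennreal (G x powr q) \<partial>N) \<le> ennreal ((B + e * K) powr q)"
    using bound by (auto simp: eventually_at_filter)
  ultimately show ?thesis
    using tendsto_lowerbound[of _ _ "at_right (0::real)"] by fastforce
qed

section \<open>Integral means over rotations\<close>

text \<open>
  The \<open>L\<^sup>p\<close> norm of \<open>g\<close> on \<open>[0, 2\<pi>]\<close> is at most \<open>C\<close>. For \<open>p = \<infinity>\<close> the supremum is taken over all points
  rather than almost all of them, which agrees for the continuous functions in question.
\<close>

definition mean_le :: "ennreal \<Rightarrow> (real \<Rightarrow> real) \<Rightarrow> real \<Rightarrow> bool" where
  "mean_le p g C \<longleftrightarrow>
     (if p = \<infinity> then \<forall>\<eta>\<in>{0..2*pi}. g \<eta> \<le> C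
      else (\<integral>\<^sup>+\<eta>\<in>{0..2*pi}. ennreal (g \<eta> powr enn2real p) \<partial>lborel) \<le> ennreal (C powr enn2real p))"

lemma enn2real_ge: "p \<noteq> \<infinity> \<Longrightarrow> ennreal c \<le> p \<Longrightarrow> 0 \<le> c \<Longrightarrow> c \<le> enn2real p"
  by (cases p) auto

lemma mean_le_mono:
  assumes "mean_le p g C" "\<And>\<eta>. \<eta> \<in> {0..2*pi} \<Longrightarrow> 0 \<le> g' \<eta> \<and> g' \<eta> \<le> g \<eta>" "C \<le> C'" "0 \<le> C"
  shows "mean_le p g' C'"
proof (cases "p = \<infinity>")
  case False
  have "(\<integral>\<^sup>+\<eta>\<in>{0..2*pi}. ennreal (g' \<eta> powr enn2real p) \<partial>lborel)
      \<le> (\<integral>\<^sup>+\<eta>\<in>{0..2*pi}. ennreal (g \<eta> powr enn2real p) \<partial>lborel)"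
    using assms(2) by (intro nn_integral_mono)
      (auto simp: indicator_def intro!: ennreal_leI powr_mono2)
  also have "\<dots> \<le> ennreal (C powr enn2real p)"
    using assms(1) False by (simp add: mean_le_def)
  also have "\<dots> \<le> ennreal (C' powr enn2real p)"
    using assms by (intro ennreal_leI powr_mono2) auto
  finally show ?thesis using False by (simp add: mean_le_def)
qed (use assms in \<open>force simp: mean_le_def\<close>)

lemma mean_le_cmult:
  assumes "mean_le p g C" "0 \<le> c" "0 \<le> C" "\<And>\<eta>. 0 \<le> g \<eta>" "g \<in> borel_measurable borel"
  shows "mean_le p (\<lambda>\<eta>. c * g \<eta>) (c * C)"
proof (cases "p = \<infinity>")
  case False
  note [measurable] = assms(5)
  have "(\<integral>\<^sup>+\<eta>\<in>{0..2*pi}. ennreal ((c * g \<eta>) powr enn2real p) \<partial>lborel)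
      = ennreal (c powr enn2real p) * (\<integral>\<^sup>+\<eta>\<in>{0..2*pi}. ennreal (g \<eta> powr enn2real p) \<partial>lborel)"
    using assms by (subst nn_integral_cmult[symmetric])
      (auto simp: powr_mult ennreal_mult mult.assoc intro!: nn_integral_cong)
  also have "\<dots> \<le> ennreal (c powr enn2real p) * ennreal (C powr enn2real p)"
    using assms(1) False by (intro mult_left_mono) (auto simp: mean_le_def)
  finally show ?thesis using False assms
    by (simp add: mean_le_def powr_mult ennreal_mult)
qed (use assms in \<open>auto simp: mean_le_def intro!: mult_left_mono\<close>)

text \<open>
  Passing between \<open>L\<^sup>p\<close> and \<open>L\<^bsup>p/2\<^esup>\<close>; at \<open>p = \<infinity>\<close> this relies on \<open>\<infinity> / 2 = \<infinity>\<close>.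
\<close>

lemma mean_le_power2:
  assumes "\<And>\<eta>. 0 \<le> g \<eta>" "0 \<le> C"
  shows "mean_le (p / 2) (\<lambda>\<eta>. (g \<eta>)\<^sup>2) (C\<^sup>2) \<longleftrightarrow> mean_le p g C"
proof (cases "p = \<infinity>")
  case True
  then show ?thesis using assms
    by (auto simp: mean_le_def ennreal_top_divide power2_le_iff_abs_le)
next
  case False
  then obtain r where r: "p = ennreal r" "0 \<le> r" by (cases p) auto
  have p2: "p / 2 = ennreal (r / 2)"
    using r by (simp add: divide_ennreal[of r 2, simplified])
  have "(x\<^sup>2) powr (r / 2) = x powr r" if "0 \<le> x" for x :: real
    using that by (simp add: powr_powr flip: powr_numeral)
  then show ?thesis using assms r p2 by (simp add: mean_le_def)
qed

text \<open>
  Minkowski's integral inequality for all \<open>p\<close> from \<open>1\<close> to \<open>\<infinity>\<close>. Continuity is required on \<open>S\<close> only, so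
  that the bound \<open>b\<close> may blow up at the boundary of \<open>S\<close>.
\<close>

lemma mean_le_Minkowski:
  fixes h :: "real \<Rightarrow> real \<Rightarrow> real"
  assumes p: "1 \<le> p" and S: "S \<in> sets borel"
    and hc: "continuous_on (S \<times> UNIV) (\<lambda>(s, \<eta>). h s \<eta>)" and bc: "continuous_on S b"
    and h: "\<And>s \<eta>. 0 \<le> h s \<eta>" and b: "\<And>s. s \<in> S \<Longrightarrow> 0 \<le> b s"
    and hb: "\<And>s. s \<in> S \<Longrightarrow> mean_le p (h s) (b s)"
    and B: "(\<integral>\<^sup>+s\<in>S. ennreal (b s) \<partial>lborel) \<le> ennreal B" "0 \<le> B"
    and G: "\<And>\<eta>. 0 \<le> G \<eta>"
      "\<And>\<eta>. \<eta> \<in> {0..2*pi} \<Longrightarrow> ennreal (G \<eta>) \<le> (\<integral>\<^sup>+s\<in>S. ennreal (h s \<eta>) \<partial>lborel)"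
  shows "mean_le p G B"
proof (cases "p = \<infinity>")
  case True
  show ?thesis unfolding mean_le_def using True
  proof (simp, intro ballI)
    fix \<eta> :: real assume \<eta>: "\<eta> \<in> {0..2*pi}"
    have "ennreal (G \<eta>) \<le> (\<integral>\<^sup>+s\<in>S. ennreal (h s \<eta>) \<partial>lborel)" by (rule G(2)[OF \<eta>])
    also have "\<dots> \<le> (\<integral>\<^sup>+s\<in>S. ennreal (b s) \<partial>lborel)"
      using hb \<eta> True by (intro nn_integral_mono) (auto simp: mean_le_def indicator_def intro!: ennreal_leI)
    also have "\<dots> \<le> ennreal B" by (rule B)
    finally show "G \<eta> \<le> B" using B by simp
  qed
next
  case False
  define q where "q = enn2real p"
  have q: "1 \<le> q" unfolding q_def using False p by (intro enn2real_ge) auto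
  define I :: "real set" where "I = {0..2*pi}"
  have [measurable]: "I \<in> sets borel" "S \<in> sets borel" using S by (auto simp: I_def)
  have "(\<lambda>x. indicator (S \<times> UNIV) x *\<^sub>R (case x of (s, \<eta>) \<Rightarrow> h s \<eta>)) \<in> borel_measurable borel"
    by (rule borel_measurable_continuous_on_indicator[OF _ hc]) (simp add: borel_Times S)
  then have "(\<lambda>x. indicator (S \<times> UNIV) x *\<^sub>R (case x of (s, \<eta>) \<Rightarrow> h s \<eta>)) \<in> borel_measurable (borel \<Otimes>\<^sub>M borel)"
    by (simp add: borel_prod)
  then have m: "(\<lambda>(s, \<eta>). indicator S s * h s \<eta>) \<in> borel_measurable (borel \<Otimes>\<^sub>M borel)"
    by (rule measurable_cong[THEN iffD1, rotated]) (auto simp: indicator_def)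
  have m2: "(\<lambda>(s, \<eta>). indicator I \<eta> * (indicator S s * h s \<eta>)) \<in> borel_measurable (lborel \<Otimes>\<^sub>M lborel)"
    using m by measurable
  have bm: "(\<lambda>s. indicator S s * b s) \<in> borel_measurable lborel"
    using borel_measurable_continuous_on_indicator[OF S bc] by simp
  have "(\<integral>\<^sup>+\<eta>. ennreal ((indicator I \<eta> * G \<eta>) powr q) \<partial>lborel) \<le> ennreal (B powr q)"
  proof (rule Minkowski_integral_inequality[OF _ _ q m2 bm])
    show "sigma_finite_measure lborel" "sigma_finite_measure lborel"
      by (rule sigma_finite_lborel)+
    show "(\<integral>\<^sup>+\<eta>. ennreal ((indicator I \<eta> * (indicator S s * h s \<eta>)) powr q) \<partial>lborel)
        \<le> ennreal ((indicator S s * b s) powr q)" for s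
    proof (cases "s \<in> S")
      case True
      then have "(\<integral>\<^sup>+\<eta>. ennreal ((indicator I \<eta> * (indicator S s * h s \<eta>)) powr q) \<partial>lborel)
        = (\<integral>\<^sup>+\<eta>\<in>I. ennreal (h s \<eta> powr q) \<partial>lborel)"
        by (intro nn_integral_cong) (auto simp: indicator_def)
      then show ?thesis using hb[OF True] False True by (simp add: mean_le_def q_def I_def)
    qed simp
    show "(\<integral>\<^sup>+s. ennreal (indicator S s * b s) \<partial>lborel) \<le> ennreal B"
      using B(1) by (rule order_trans[rotated]) (auto intro!: nn_integral_mono simp: indicator_def)
    show "ennreal (indicator I \<eta> * G \<eta>)
        \<le> (\<integral>\<^sup>+s. ennreal (indicator I \<eta> * (indicator S s * h s \<eta>)) \<partial>lborel)" for \<eta>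
    proof (cases "\<eta> \<in> I")
      case True
      then have "ennreal (G \<eta>) \<le> (\<integral>\<^sup>+s\<in>S. ennreal (h s \<eta>) \<partial>lborel)" by (intro G) (simp add: I_def)
      also have "\<dots> = (\<integral>\<^sup>+s. ennreal (indicator I \<eta> * (indicator S s * h s \<eta>)) \<partial>lborel)"
        using True by (intro nn_integral_cong) (auto simp: indicator_def)
      finally show ?thesis using True by simp
    qed simp
  qed (use h b B G in \<open>auto simp: indicator_def\<close>)
  also have "(\<integral>\<^sup>+\<eta>. ennreal ((indicator I \<eta> * G \<eta>) powr q) \<partial>lborel) = (\<integral>\<^sup>+\<eta>\<in>I. ennreal (G \<eta> powr q) \<partial>lborel)"
    by (intro nn_integral_cong) (auto simp: indicator_def)
  finally show ?thesis using False by (simp add: mean_le_def q_def I_def)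
qed

text \<open>
  A crude triangle inequality: the factor 9 in place of 3 comes from estimating
  \<open>(a + b + c)\<^sup>q \<le> 3\<^sup>q (a\<^sup>q + b\<^sup>q + c\<^sup>q)\<close>.
\<close>

lemma mean_le_sum3:
  assumes p: "1 \<le> p" and m: "g1 \<in> borel_measurable borel" "g2 \<in> borel_measurable borel" "g3 \<in> borel_measurable borel"
    and g: "\<And>\<eta>. 0 \<le> g1 \<eta>" "\<And>\<eta>. 0 \<le> g2 \<eta>" "\<And>\<eta>. 0 \<le> g3 \<eta>"
    and l: "mean_le p g1 C" "mean_le p g2 C" "mean_le p g3 C" and C: "0 \<le> C"
    and G: "\<And>\<eta>. 0 \<le> G \<eta>" "\<And>\<eta>. G \<eta> \<le> g1 \<eta> + g2 \<eta> + g3 \<eta>"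
  shows "mean_le p G (9 * C)"
proof (cases "p = \<infinity>")
  case True
  show ?thesis unfolding mean_le_def using True
  proof (simp, intro ballI)
    fix \<eta> :: real assume \<eta>: "\<eta> \<in> {0..2*pi}"
    have "g1 \<eta> \<le> C" "g2 \<eta> \<le> C" "g3 \<eta> \<le> C" using l \<eta> True by (auto simp: mean_le_def)
    then show "G \<eta> \<le> 9 * C" using G(2)[of \<eta>] C by linarith
  qed
next
  case False
  define q where "q = enn2real p"
  have q: "1 \<le> q" unfolding q_def using False p by (intro enn2real_ge) auto
  note [measurable] = m
  have pt: "G \<eta> powr q \<le> 3 powr q * (g1 \<eta> powr q + g2 \<eta> powr q + g3 \<eta> powr q)" for \<eta>
  proof -
    define x where "x = max (g1 \<eta>) (max (g2 \<eta>) (g3 \<eta>))"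
    have "G \<eta> \<le> 3 * x" using G(2)[of \<eta>] by (auto simp: x_def)
    then have "G \<eta> powr q \<le> (3 * x) powr q"
      using G q by (intro powr_mono2) auto
    also have "\<dots> = 3 powr q * x powr q"
      using g(1)[of \<eta>] by (simp add: powr_mult x_def)
    also have "x powr q \<le> g1 \<eta> powr q + g2 \<eta> powr q + g3 \<eta> powr q"
      by (simp add: x_def max_def)
    finally show ?thesis by simp
  qed
  have "(\<integral>\<^sup>+\<eta>\<in>{0..2*pi}. ennreal (G \<eta> powr q) \<partial>lborel)
      \<le> (\<integral>\<^sup>+\<eta>. ennreal (3 powr q) * (ennreal (g1 \<eta> powr q) * indicator {0..2*pi} \<eta> +
           ennreal (g2 \<eta> powr q) * indicator {0..2*pi} \<eta> +
           ennreal (g3 \<eta> powr q) * indicator {0..2*pi} \<eta>) \<partial>lborel)"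
    by (intro nn_integral_mono)
      (auto simp: indicator_def ennreal_mult[symmetric] simp flip: ennreal_plus intro!: ennreal_leI pt)
  also have "\<dots> = ennreal (3 powr q) * ((\<integral>\<^sup>+\<eta>\<in>{0..2*pi}. ennreal (g1 \<eta> powr q) \<partial>lborel)
      + (\<integral>\<^sup>+\<eta>\<in>{0..2*pi}. ennreal (g2 \<eta> powr q) \<partial>lborel) + (\<integral>\<^sup>+\<eta>\<in>{0..2*pi}. ennreal (g3 \<eta> powr q) \<partial>lborel))"
    by (subst nn_integral_cmult, measurable, subst nn_integral_add, measurable, subst nn_integral_add, measurable)
  also have "\<dots> \<le> ennreal (3 powr q) * (ennreal (C powr q) + ennreal (C powr q) + ennreal (C powr q))"
    using l False by (intro mult_left_mono add_mono) (auto simp: mean_le_def q_def)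
  also have "ennreal (C powr q) + ennreal (C powr q) + ennreal (C powr q) = ennreal (3 * C powr q)"
    by (simp flip: ennreal_plus)
  also have "ennreal (3 powr q) * ennreal (3 * C powr q) = ennreal (3 powr q * (3 * C powr q))"
    by (simp add: ennreal_mult)
  also have "\<dots> \<le> ennreal ((9 * C) powr q)"
  proof (rule ennreal_leI)
    have "3 powr q * (3 powr 1 * C powr q) \<le> 3 powr q * (3 powr q * C powr q)"
      using q by (intro mult_left_mono mult_right_mono powr_mono) auto
    also have "\<dots> = (9 * C) powr q"
      using C powr_mult[of 3 3 q] by (simp add: powr_mult)
    finally show "3 powr q * (3 * C powr q) \<le> (9 * C) powr q" by simp
  qed
  finally show ?thesis using False by (simp add: mean_le_def q_def)
qed

text \<open>
  Fatou's lemma.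
\<close>

lemma mean_le_tendsto:
  assumes p: "1 \<le> p" and gm: "\<And>n. g n \<in> borel_measurable borel" and g: "\<And>n \<eta>. 0 \<le> g n \<eta>"
    and l: "\<And>n. mean_le p (g n) C" and lim: "\<And>\<eta>. (\<lambda>n. g n \<eta>) \<longlonglongrightarrow> G \<eta>"
  shows "mean_le p G C"
proof (cases "p = \<infinity>")
  case True
  show ?thesis unfolding mean_le_def using True
  proof (simp, intro ballI)
    fix \<eta> :: real assume \<eta>: "\<eta> \<in> {0..2*pi}"
    show "G \<eta> \<le> C" using l \<eta> True
      by (intro LIMSEQ_le_const2[OF lim]) (auto simp: mean_le_def)
  qed
next
  case False
  define q where "q = enn2real p"
  have q: "1 \<le> q" unfolding q_def using False p by (intro enn2real_ge) auto
  note [measurable] = gm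
  have "(\<lambda>n. ennreal (g n \<eta> powr q) * indicator {0..2*pi} \<eta>) \<longlonglongrightarrow> ennreal (G \<eta> powr q) * indicator {0..2*pi} \<eta>" for \<eta>
    using q g lim[of \<eta>] by (cases "\<eta> \<in> {0..2*pi}") (auto intro!: tendsto_ennrealI tendsto_powr')
  then have "(\<integral>\<^sup>+\<eta>\<in>{0..2*pi}. ennreal (G \<eta> powr q) \<partial>lborel)
     = (\<integral>\<^sup>+\<eta>. liminf (\<lambda>n. ennreal (g n \<eta> powr q) * indicator {0..2*pi} \<eta>) \<partial>lborel)"
    by (intro nn_integral_cong lim_imp_Liminf[symmetric]) auto
  also have "\<dots> \<le> liminf (\<lambda>n. \<integral>\<^sup>+\<eta>\<in>{0..2*pi}. ennreal (g n \<eta> powr q) \<partial>lborel)"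
    by (rule nn_integral_liminf) measurable
  also have "\<dots> \<le> liminf (\<lambda>n::nat. ennreal (C powr q))"
    using l False by (intro Liminf_mono) (auto simp: mean_le_def q_def)
  also have "\<dots> = ennreal (C powr q)" by (simp add: Liminf_const)
  finally show ?thesis using False by (simp add: mean_le_def q_def)
qed

lemma powr_inverse_le_iff:
  fixes x K q :: real
  assumes "0 < q" "0 \<le> x" "0 \<le> K"
  shows "x powr (1 / q) \<le> K \<longleftrightarrow> x \<le> K powr q"
  using powr_mono2[of q "x powr (1/q)" K] powr_mono2[of "1/q" x "K powr q"] assms
  by (auto simp: powr_powr)

lemma int_mean_diff_le_iff:
  assumes "1 \<le> p" "p \<noteq> \<infinity>" "0 \<le> K"
  shows "int_mean_diff p F z1 z2 \<le> ennreal K \<longleftrightarrow>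
    mean_le p (\<lambda>\<eta>. cmod (F (cis \<eta> * z1) - F (cis \<eta> * z2))) K"
proof -
  define q where "q = enn2real p"
  have q: "1 \<le> q" unfolding q_def using assms by (intro enn2real_ge) auto
  have "ennreal_powr X (1 / q) \<le> ennreal K \<longleftrightarrow> X \<le> ennreal (K powr q)" for X
  proof (cases X)
    case (real r)
    then show ?thesis using q assms by (simp add: ennreal_powr_def powr_inverse_le_iff)
  qed (simp add: ennreal_powr_def top_unique)
  then show ?thesis using assms by (simp add: int_mean_diff_def mean_le_def q_def)
qed

section \<open>The Poisson variance of a function in the disk algebra\<close>

lemma disk_algebra_iff:
  "f \<in> disk_algebra \<longleftrightarrow> f holomorphic_on ball 0 1 \<and> continuous_on (cball 0 1) f"
  by (auto simp: disk_algebra_def analytic_on_open)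

lemma disk_algebra_continuous_on_comp:
  assumes "f \<in> disk_algebra" "continuous_on S g" "\<And>x. x \<in> S \<Longrightarrow> cmod (g x) \<le> 1"
  shows "continuous_on S (\<lambda>x. f (g x))"
  by (rule continuous_on_compose2[of "cball 0 1" f, OF _ assms(2)]) (use assms(1,3) in \<open>auto simp: disk_algebra_iff\<close>)

lemma continuous_on_cis_comp:
  "continuous_on (sphere 0 1) g \<Longrightarrow> continuous_on S (\<lambda>\<tau>. g (cis \<tau>))"
  by (rule continuous_on_compose2[of "sphere 0 1" g]) (auto intro!: continuous_intros)

text \<open>
  It suffices to rotate by an angle \<open>a\<close> in \<open>[0, 2\<pi>]\<close>; then the part of \<open>[a, 2\<pi> + a]\<close> beyond \<open>2\<pi>\<close> is
  moved back to \<open>[0, a]\<close> by periodicity.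
\<close>

lemma integral_cis_rotate:
  fixes g :: "complex \<Rightarrow> real"
  assumes g: "continuous_on (sphere 0 1) g" and v: "cmod v = 1"
  shows "integral {0..2*pi} (\<lambda>\<tau>. g (cis \<tau> * v)) = integral {0..2*pi} (\<lambda>\<tau>. g (cis \<tau>))"
proof -
  define a where "a = Arg2pi v"
  have a: "0 \<le> a" "a \<le> 2 * pi" and va: "v = cis a"
    using Arg2pi[of v] v Arg2pi_eq[of v] by (auto simp: a_def cis_conv_exp)
  have int: "(\<lambda>\<tau>. g (cis \<tau>)) integrable_on {x..y}" for x y
    by (rule integrable_continuous_real continuous_on_cis_comp g)+
  have shift: "integral {x + c..y + c} (\<lambda>\<tau>. g (cis \<tau>)) = integral {x..y} (\<lambda>\<tau>. g (cis (\<tau> + c)))" for x y c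
    using integral_shift_Icc_real[of x y "\<lambda>\<tau>. g (cis \<tau>)" c] by (simp add: o_def add.commute)
  have "integral {0..2*pi} (\<lambda>\<tau>. g (cis \<tau> * v)) = integral {a..2*pi + a} (\<lambda>\<tau>. g (cis \<tau>))"
    using shift[of 0 a "2*pi"] by (simp add: va cis_mult)
  also have "\<dots> = integral {a..2*pi} (\<lambda>\<tau>. g (cis \<tau>)) + integral {2*pi..2*pi + a} (\<lambda>\<tau>. g (cis \<tau>))"
    using a int by (intro Henstock_Kurzweil_Integration.integral_combine[symmetric]) auto
  also have "integral {2*pi..2*pi + a} (\<lambda>\<tau>. g (cis \<tau>)) = integral {0..a} (\<lambda>\<tau>. g (cis \<tau>))"
    using shift[of 0 "2*pi" a] by (simp add: add.commute flip: cis_mult)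
  also have "integral {a..2*pi} (\<lambda>\<tau>. g (cis \<tau>)) + \<dots> = integral {0..2*pi} (\<lambda>\<tau>. g (cis \<tau>))"
    using Henstock_Kurzweil_Integration.integral_combine[OF a int] by simp
  finally show ?thesis .
qed

definition poisson_kernel :: "complex \<Rightarrow> real \<Rightarrow> real" where
  "poisson_kernel z \<tau> = (1 - (cmod z)\<^sup>2) / (cmod (cis \<tau> - z))\<^sup>2"

lemma cis_minus_nonzero: "cmod z < 1 \<Longrightarrow> cis \<tau> - z \<noteq> 0"
  using norm_cis[of \<tau>] by force

lemma poisson_kernel_pos: "cmod z < 1 \<Longrightarrow> 0 < poisson_kernel z \<tau>"
  using cis_minus_nonzero[of z \<tau>] by (auto simp: poisson_kernel_def abs_square_less_1)

lemma continuous_on_poisson_kernel: "cmod z < 1 \<Longrightarrow> continuous_on S (poisson_kernel z)"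
  unfolding poisson_kernel_def using cis_minus_nonzero[of z]
  by (auto intro!: continuous_intros)

text \<open>
  On the unit circle \<open>\<zeta> (cnj \<zeta> - cnj z) = 1 - cnj z \<zeta>\<close>, so the Poisson kernel is the boundary value of
  a holomorphic factor times the Cauchy kernel.
\<close>

lemma poisson_kernel_complex:
  assumes "cmod z < 1"
  shows "(1 - (cmod z)\<^sup>2) / (1 - cnj z * cis \<tau>) / (cis \<tau> - z) * cis \<tau> = of_real (poisson_kernel z \<tau>)"
proof -
  have "1 - cnj z * cis \<tau> = cis \<tau> * cnj (cis \<tau> - z)"
    by (simp add: algebra_simps cis_cnj flip: cis_mult) (simp add: cis_mult)
  moreover have "of_real ((cmod (cis \<tau> - z))\<^sup>2) = cnj (cis \<tau> - z) * (cis \<tau> - z)"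
    using complex_norm_square[of "cis \<tau> - z"] by (simp only: of_real_power mult.commute)
  ultimately show ?thesis
    unfolding poisson_kernel_def of_real_divide by (simp del: complex_cnj_diff)
qed

text \<open>
  Cauchy's formula for \<open>u \<mapsto> f(u) (1 - |z|\<^sup>2) / (1 - cnj z u)\<close>, which is again in the disk algebra and
  takes the value \<open>f(z)\<close> at \<open>z\<close>.
\<close>

lemma poisson_formula:
  fixes f :: "complex \<Rightarrow> complex"
  assumes f: "f \<in> disk_algebra" and z: "cmod z < 1"
  shows "((\<lambda>\<tau>. f (cis \<tau>) * of_real (poisson_kernel z \<tau>)) has_integral 2 * of_real pi * f z) {0..2*pi}"
proof -
  define g where "g u = f u * (1 - (cmod z)\<^sup>2) / (1 - cnj z * u)" for u
  have nz: "1 - cnj z * u \<noteq> 0" if "cmod u \<le> 1" for u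
  proof
    assume "1 - cnj z * u = 0"
    then have "cmod z * cmod u = 1"
      by (metis complex_mod_cnj norm_mult norm_one right_minus_eq)
    moreover have "cmod z * cmod u \<le> cmod z * 1" using that by (intro mult_left_mono) auto
    ultimately show False using z by simp
  qed
  have "((\<lambda>u. g u / (u - z)) has_contour_integral (2 * of_real pi * \<i> * g z)) (circlepath 0 1)"
  proof (rule Cauchy_integral_circlepath)
    show "continuous_on (cball 0 1) g" "g holomorphic_on ball 0 1"
      unfolding g_def using f nz by (auto simp: disk_algebra_iff intro!: continuous_intros holomorphic_intros)
  qed (use z in auto)
  then have "((\<lambda>t. g (cis t) / (cis t - z) * \<i> * cis t) has_integral (2 * of_real pi * \<i> * g z)) {0..2*pi}"
    by (simp add: circlepath_def has_contour_integral_part_circlepath_iff)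
  from has_integral_mult_left[OF this, of "-\<i>"]
  have "((\<lambda>t. g (cis t) / (cis t - z) * cis t) has_integral (2 * of_real pi * g z)) {0..2*pi}"
    by (simp add: mult_ac)
  moreover have "g z = f z"
    using nz[of z] z by (simp add: g_def complex_norm_square[symmetric] mult.commute[of "cnj z"] flip: of_real_power)
  moreover have "g (cis t) / (cis t - z) * cis t = f (cis t) * of_real (poisson_kernel z t)" for t
    using poisson_kernel_complex[OF z, of t] by (simp add: g_def mult_ac flip: times_divide_eq_right)
  ultimately show ?thesis by simp
qed

lemma has_integral_poisson_kernel:
  assumes "cmod z < 1"
  shows "(poisson_kernel z has_integral 2 * pi) {0..2*pi}"
proof -
  have "(\<lambda>_. 1 :: complex) \<in> disk_algebra" by (simp add: disk_algebra_iff)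
  from has_integral_Re[OF poisson_formula[OF this assms]] show ?thesis by simp
qed

lemma poisson_integral_eq:
  assumes "continuous_on (sphere 0 1) \<phi>" "cmod z < 1"
  shows "poisson_integral \<phi> z = integral {0..2*pi} (\<lambda>\<tau>. \<phi> (cis \<tau>) * poisson_kernel z \<tau>) / (2 * pi)"
proof -
  have "set_integrable lborel {0..2*pi} (\<lambda>\<tau>. \<phi> (cis \<tau>) * poisson_kernel z \<tau>)"
    by (intro borel_integrable_atLeastAtMost' continuous_intros continuous_on_cis_comp
        continuous_on_poisson_kernel assms)
  from set_borel_integral_eq_integral(2)[OF this] show ?thesis
    by (simp add: poisson_integral_def poisson_kernel_def)
qed

lemma disk_algebra_continuous_on_sphere: "f \<in> disk_algebra \<Longrightarrow> continuous_on (sphere 0 1) f"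
  by (auto simp: disk_algebra_iff intro: continuous_on_subset)

text \<open>
  The variance of \<open>f\<close> under the harmonic measure of the disk seen from \<open>z\<close>, by \<open>poisson_variance_eq\<close>.
\<close>

definition poisson_variance :: "(complex \<Rightarrow> complex) \<Rightarrow> complex \<Rightarrow> real" where
  "poisson_variance f z = poisson_integral (\<lambda>\<zeta>. (cmod (f \<zeta>))\<^sup>2) z - (cmod (f z))\<^sup>2"

text \<open>
  Expand \<open>|f(\<zeta>) - f(z)|\<^sup>2\<close> and use that the Poisson kernel reproduces \<open>1\<close> and \<open>f\<close>.
\<close>

lemma poisson_variance_eq:
  assumes f: "f \<in> disk_algebra" and z: "cmod z < 1"
  shows "poisson_variance f z = integral {0..2*pi} (\<lambda>\<tau>. (cmod (f (cis \<tau>) - f z))\<^sup>2 * poisson_kernel z \<tau>) / (2 * pi)"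
proof -
  note fs = disk_algebra_continuous_on_sphere[OF f]
  define c where "c = f z"
  have 1: "((\<lambda>\<tau>. (cmod (f (cis \<tau>)))\<^sup>2 * poisson_kernel z \<tau>) has_integral
      2 * pi * poisson_integral (\<lambda>\<zeta>. (cmod (f \<zeta>))\<^sup>2) z) {0..2*pi}"
    by (subst poisson_integral_eq, intro continuous_intros fs, fact, simp)
      (intro integrable_integral integrable_continuous_real continuous_intros
        continuous_on_cis_comp[OF fs] continuous_on_poisson_kernel z)
  have pf: "((\<lambda>\<tau>. f (cis \<tau>) * of_real (poisson_kernel z \<tau>)) has_integral of_real (2 * pi) * f z) {0..2*pi}"
    using poisson_formula[OF f z] by simp
  have 2: "((\<lambda>\<tau>. Re (cnj c * (f (cis \<tau>) * of_real (poisson_kernel z \<tau>)))) has_integral 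
      Re (cnj c * (2 * pi * f z))) {0..2*pi}"
    by (intro has_integral_Re has_integral_mult_right pf)
  have "((\<lambda>\<tau>. (cmod (f (cis \<tau>)))\<^sup>2 * poisson_kernel z \<tau> - 2 * Re (cnj c * (f (cis \<tau>) * of_real (poisson_kernel z \<tau>)))
      + (cmod c)\<^sup>2 * poisson_kernel z \<tau>) has_integral
      2 * pi * poisson_integral (\<lambda>\<zeta>. (cmod (f \<zeta>))\<^sup>2) z - 2 * Re (cnj c * (2 * pi * f z)) + (cmod c)\<^sup>2 * (2 * pi)) {0..2*pi}"
    by (intro has_integral_add has_integral_diff has_integral_mult_right 1 2 has_integral_poisson_kernel z)
  also have "(\<lambda>\<tau>. (cmod (f (cis \<tau>)))\<^sup>2 * poisson_kernel z \<tau> - 2 * Re (cnj c * (f (cis \<tau>) * of_real (poisson_kernel z \<tau>)))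
      + (cmod c)\<^sup>2 * poisson_kernel z \<tau>) = (\<lambda>\<tau>. (cmod (f (cis \<tau>) - c))\<^sup>2 * poisson_kernel z \<tau>)"
    by (rule ext) (simp only: cmod_power2 minus_complex.sel, simp add: algebra_simps power2_eq_square)
  also have "2 * Re (cnj c * (2 * pi * f z)) = 2 * (2 * pi) * (cmod c)\<^sup>2"
    unfolding c_def cmod_power2 by (simp add: algebra_simps power2_eq_square)
  finally have "integral {0..2*pi} (\<lambda>\<tau>. (cmod (f (cis \<tau>) - c))\<^sup>2 * poisson_kernel z \<tau>)
      = 2 * pi * poisson_integral (\<lambda>\<zeta>. (cmod (f \<zeta>))\<^sup>2) z - 2 * (2 * pi) * (cmod c)\<^sup>2 + (cmod c)\<^sup>2 * (2 * pi)"
    by (rule integral_unique)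
  also have "\<dots> = 2 * pi * poisson_variance f z"
    by (simp add: poisson_variance_def c_def algebra_simps)
  finally show ?thesis unfolding c_def by simp
qed

lemma poisson_variance_nonneg:
  assumes f: "f \<in> disk_algebra" and z: "cmod z < 1"
  shows "0 \<le> poisson_variance f z"
  unfolding poisson_variance_eq[OF assms] using poisson_kernel_pos[OF z]
  by (intro divide_nonneg_pos Henstock_Kurzweil_Integration.integral_nonneg integrable_continuous_real continuous_intros
      continuous_on_cis_comp disk_algebra_continuous_on_sphere f continuous_on_poisson_kernel z)
    (auto intro!: mult_nonneg_nonneg simp: less_imp_le)

text \<open>
  On the circle \<open>1 / |\<zeta> - z|\<^sup>2\<close> is the Poisson kernel divided by \<open>1 - |z|\<^sup>2\<close>. Hence Cauchy's formula for
  the derivative of \<open>f - f(z)\<close> bounds \<open>(1 - |z|\<^sup>2) |f'(z)|\<close> by the Poisson mean \<open>m\<close> of \<open>|f - f(z)|\<close>,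
  and \<open>m\<^sup>2\<close> is at most the Poisson mean of \<open>|f - f(z)|\<^sup>2\<close>.
\<close>

lemma norm_deriv_le_poisson_variance:
  assumes f: "f \<in> disk_algebra" and z: "cmod z < 1"
  shows "(1 - (cmod z)\<^sup>2) * cmod (deriv f z) \<le> sqrt (poisson_variance f z)"
proof -
  define k where "k \<tau> = cmod (f (cis \<tau>) - f z)" for \<tau>
  have kc: "continuous_on S k" for S
    unfolding k_def by (intro continuous_intros continuous_on_cis_comp disk_algebra_continuous_on_sphere f)
  define P where "P = poisson_kernel z"
  have Pc: "continuous_on S P" for S unfolding P_def by (rule continuous_on_poisson_kernel[OF z])
  have P0: "0 < P \<tau>" for \<tau> unfolding P_def by (rule poisson_kernel_pos[OF z])
  have d: "0 < 1 - (cmod z)\<^sup>2" using z by (auto simp: abs_square_less_1)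
  define m where "m = integral {0..2*pi} (\<lambda>\<tau>. k \<tau> * P \<tau>) / (2 * pi)"
  have i1: "((\<lambda>\<tau>. k \<tau> * P \<tau>) has_integral 2 * pi * m) {0..2*pi}"
    unfolding m_def by (simp, intro integrable_integral integrable_continuous_real continuous_intros kc Pc)
  have "(1 - (cmod z)\<^sup>2) * cmod (deriv f z) \<le> m"
  proof -
    define g where "g u = f u - f z" for u
    have g: "continuous_on (cball 0 1) g" "g holomorphic_on ball 0 1"
      unfolding g_def using f by (auto simp: disk_algebra_iff intro!: continuous_intros holomorphic_intros)
    have z1: "z \<in> ball 0 1" using z by simp
    have "deriv g z = 1 / (2 * of_real pi * \<i>) * contour_integral (circlepath 0 1) (\<lambda>u. g u / (u - z)\<^sup>2)"
      by (intro DERIV_imp_deriv Cauchy_derivative_integral_circlepath(2) g z1)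
    also have "contour_integral (circlepath 0 1) (\<lambda>u. g u / (u - z)\<^sup>2) =
       integral {0..2*pi} (\<lambda>t. g (cis t) / (cis t - z)\<^sup>2 * \<i> * cis t)"
      by (simp add: circlepath_def contour_integral_part_circlepath_eq)
    also have "deriv g z = deriv f z"
      unfolding g_def using f z1 by (subst deriv_diff)
        (auto simp: disk_algebra_iff intro: holomorphic_on_imp_differentiable_at)
    finally have 1: "cmod (deriv f z) = cmod (integral {0..2*pi} (\<lambda>t. g (cis t) / (cis t - z)\<^sup>2 * \<i> * cis t)) / (2 * pi)"
      by (simp add: norm_divide norm_mult)
    have "cmod (integral {0..2*pi} (\<lambda>t. g (cis t) / (cis t - z)\<^sup>2 * \<i> * cis t))
       \<le> integral {0..2*pi} (\<lambda>\<tau>. k \<tau> * P \<tau> / (1 - (cmod z)\<^sup>2))"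
    proof (rule integral_norm_bound_integral)
      show "(\<lambda>t. g (cis t) / (cis t - z)\<^sup>2 * \<i> * cis t) integrable_on {0..2*pi}"
        using cis_minus_nonzero[OF z]
        by (intro integrable_continuous_real continuous_intros continuous_on_cis_comp
            continuous_on_subset[OF g(1)]) auto
      show "(\<lambda>\<tau>. k \<tau> * P \<tau> / (1 - (cmod z)\<^sup>2)) integrable_on {0..2*pi}"
        using d by (intro integrable_continuous_real continuous_intros kc Pc) auto
      show "cmod (g (cis t) / (cis t - z)\<^sup>2 * \<i> * cis t) \<le> k t * P t / (1 - (cmod z)\<^sup>2)" for t
        using d by (simp add: g_def k_def P_def poisson_kernel_def norm_divide norm_mult norm_power)
    qed
    also have "\<dots> = 2 * pi * m / (1 - (cmod z)\<^sup>2)"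
      by (rule integral_unique[OF has_integral_divide[OF i1]])
    finally have "cmod (deriv f z) \<le> 2 * pi * m / (1 - (cmod z)\<^sup>2) / (2 * pi)"
      unfolding 1 by (rule divide_right_mono) simp
    also have "\<dots> = m / (1 - (cmod z)\<^sup>2)" by simp
    finally show ?thesis using d by (simp add: field_simps)
  qed
  moreover have "m\<^sup>2 \<le> poisson_variance f z"
  proof -
    have 1: "((\<lambda>\<tau>. (k \<tau>)\<^sup>2 * P \<tau>) has_integral 2 * pi * poisson_variance f z) {0..2*pi}"
      unfolding poisson_variance_eq[OF assms] k_def[symmetric] P_def[symmetric]
      by (simp, intro integrable_integral integrable_continuous_real continuous_intros kc Pc)
    \<comment> \<open>Cauchy-Schwarz for the probability density \<open>P / (2\<pi>)\<close>: integrate \<open>(k - m)\<^sup>2 \<ge> 0\<close>.\<close>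
    have "((\<lambda>\<tau>. (k \<tau>)\<^sup>2 * P \<tau> - 2 * m * (k \<tau> * P \<tau>) + m\<^sup>2 * P \<tau>) has_integral
       2 * pi * poisson_variance f z - 2 * m * (2 * pi * m) + m\<^sup>2 * (2 * pi)) {0..2*pi}"
      unfolding P_def by (intro has_integral_add has_integral_diff has_integral_mult_right
          1[unfolded P_def] i1[unfolded P_def] has_integral_poisson_kernel z)
    moreover have "(k \<tau>)\<^sup>2 * P \<tau> - 2 * m * (k \<tau> * P \<tau>) + m\<^sup>2 * P \<tau> = (k \<tau> - m)\<^sup>2 * P \<tau>" for \<tau>
      by (simp add: power2_eq_square algebra_simps)
    ultimately have "((\<lambda>\<tau>. (k \<tau> - m)\<^sup>2 * P \<tau>) has_integral
       2 * pi * poisson_variance f z - 2 * m * (2 * pi * m) + m\<^sup>2 * (2 * pi)) {0..2*pi}"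
      by simp
    then have "0 \<le> 2 * pi * poisson_variance f z - 2 * m * (2 * pi * m) + m\<^sup>2 * (2 * pi)"
      by (rule has_integral_nonneg) (simp add: P0 less_imp_le)
    then have "0 \<le> 2 * pi * (poisson_variance f z - m\<^sup>2)"
      by (simp add: power2_eq_square algebra_simps)
    then show ?thesis using mult_pos_neg[of "2 * pi" "poisson_variance f z - m\<^sup>2"] by force
  qed
  ultimately show ?thesis using real_le_rsqrt by fastforce
qed

text \<open>
  The kernel at \<open>r v\<close> is a rotation of the kernel at \<open>r\<close>. All points of a circle thus share the weights
  \<open>poisson_kernel r\<close>, as needed for Minkowski's inequality in the rotation angle.
\<close>

lemma poisson_variance_rotate:
  assumes f: "f \<in> disk_algebra" and r: "0 \<le> r" "r < 1" and v: "cmod v = 1"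
  shows "poisson_variance f (of_real r * v) =
    integral {0..2*pi} (\<lambda>\<tau>. (cmod (f (cis \<tau> * v) - f (of_real r * v)))\<^sup>2 * poisson_kernel (of_real r) \<tau>) / (2 * pi)"
proof -
  define w where "w = of_real r * v"
  have w: "cmod w < 1" using r v by (simp add: w_def norm_mult)
  have wr: "cmod w = r" using r v by (simp add: w_def norm_mult)
  have "integral {0..2*pi} (\<lambda>\<tau>. (cmod (f (cis \<tau>) - f w))\<^sup>2 * poisson_kernel w \<tau>)
    = integral {0..2*pi} (\<lambda>\<tau>. (\<lambda>u. (cmod (f u - f w))\<^sup>2 * ((1 - (cmod w)\<^sup>2) / (cmod (u - w))\<^sup>2)) (cis \<tau>))"
    by (simp add: poisson_kernel_def)
  also have "\<dots> = integral {0..2*pi} (\<lambda>\<tau>. (\<lambda>u. (cmod (f u - f w))\<^sup>2 * ((1 - (cmod w)\<^sup>2) / (cmod (u - w))\<^sup>2)) (cis \<tau> * v))"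
    using w by (intro integral_cis_rotate[symmetric] v continuous_intros disk_algebra_continuous_on_sphere f) auto
  also have "\<dots> = integral {0..2*pi} (\<lambda>\<tau>. (cmod (f (cis \<tau> * v) - f w))\<^sup>2 * poisson_kernel (of_real r) \<tau>)"
  proof -
    have "cis \<tau> * v - w = (cis \<tau> - of_real r) * v" for \<tau> by (simp add: w_def algebra_simps)
    then have "cmod (cis \<tau> * v - w) = cmod (cis \<tau> - of_real r)" for \<tau> by (simp add: norm_mult v)
    then show ?thesis using r by (simp add: poisson_kernel_def wr)
  qed
  finally show ?thesis using poisson_variance_eq[OF f w] by (simp add: w_def)
qed

section \<open>Regular majorants\<close>

lemma majorantD:
  assumes "majorant W"
  shows majorant_nonneg: "0 \<le> t \<Longrightarrow> 0 \<le> W t"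
    and majorant_mono: "0 \<le> s \<Longrightarrow> s \<le> t \<Longrightarrow> W s \<le> W t"
    and majorant_ratio: "0 < s \<Longrightarrow> s \<le> t \<Longrightarrow> W t / t \<le> W s / s"
    and majorant_continuous: "continuous_on {0..} W"
  using assms by (auto simp: majorant_def monotone_on_def)

lemma majorant_ratio_power2:
  assumes "majorant W" "0 < s" "s \<le> t"
  shows "W t / t\<^sup>2 \<le> W s / s\<^sup>2"
proof -
  have "W t / t * (1 / t) \<le> W s / s * (1 / s)"
    using assms majorant_nonneg[OF assms(1), of s]
    by (intro mult_mono majorant_ratio frac_le) auto
  then show ?thesis by (simp add: power2_eq_square)
qed

text \<open>
  Regularity controls only \<open>d < \<delta>\<close>. For \<open>\<delta> \<le> d \<le> 1\<close> the integral over \<open>[e, d]\<close> with \<open>e = \<delta> / 2\<close> is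
  bounded because \<open>W(t) / t\<close> is non-increasing, and \<open>W(e) \<le> W(d)\<close>.
\<close>

lemma regular_majorant_integral_near_0:
  assumes "regular_majorant W"
  obtains C where "0 < C"
    "\<And>d. 0 < d \<Longrightarrow> d \<le> 1 \<Longrightarrow> (\<integral>\<^sup>+t\<in>{0<..<d}. ennreal (W t / t) \<partial>lborel) \<le> ennreal (C * W d)"
proof -
  obtain \<delta> M where \<delta>: "0 < \<delta>" "0 < M" and W: "majorant W"
    and I: "\<And>d. 0 < d \<Longrightarrow> d < \<delta> \<Longrightarrow> (\<integral>\<^sup>+t\<in>{0<..<d}. ennreal (W t / t) \<partial>lborel) \<le> ennreal (M * W d)"
    using assms unfolding regular_majorant_def by blast
  define e where "e = \<delta> / 2"
  have e: "0 < e" "e < \<delta>" using \<delta> by (auto simp: e_def)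
  note We = majorant_nonneg[OF W, of e]
  show thesis
  proof (rule that)
    show "0 < M + 1 / e" using \<delta> e by (simp add: add_pos_pos)
    fix d :: real assume d: "0 < d" "d \<le> 1"
    note Wd = majorant_nonneg[OF W, of d]
    show "(\<integral>\<^sup>+t\<in>{0<..<d}. ennreal (W t / t) \<partial>lborel) \<le> ennreal ((M + 1 / e) * W d)"
    proof (cases "d < \<delta>")
      case True
      show ?thesis
        using I[OF d(1) True] by (rule order_trans) (use Wd d e \<delta> in \<open>auto intro!: ennreal_leI mult_right_mono\<close>)
    next
      case False
      then have ed: "e \<le> d" using e by simp
      have "(\<integral>\<^sup>+t\<in>{0<..<d}. ennreal (W t / t) \<partial>lborel) \<le>
        (\<integral>\<^sup>+t. ennreal (W t / t) * indicator {0<..<e} t + ennreal (W e / e) * indicator {e..d} t \<partial>lborel)"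
        using majorant_ratio[OF W e(1)] by (intro nn_integral_mono)
          (auto simp: indicator_def intro!: ennreal_leI)
      also have "\<dots> = (\<integral>\<^sup>+t\<in>{0<..<e}. ennreal (W t / t) \<partial>lborel) + (\<integral>\<^sup>+t. ennreal (W e / e) * indicator {e..d} t \<partial>lborel)"
      proof (rule nn_integral_add)
        have "(\<lambda>t. indicator {0<..<e} t *\<^sub>R (W t / t)) \<in> borel_measurable borel"
          by (intro borel_measurable_continuous_on_indicator continuous_intros
              continuous_on_subset[OF majorant_continuous[OF W]]) auto
        then have "(\<lambda>t. ennreal (indicator {0<..<e} t *\<^sub>R (W t / t))) \<in> borel_measurable lborel" by simp
        then show "(\<lambda>t. ennreal (W t / t) * indicator {0<..<e} t) \<in> borel_measurable lborel"
          by (rule measurable_cong[THEN iffD1, rotated]) (auto simp: indicator_def)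
      qed auto
      also have "\<dots> \<le> ennreal (M * W e) + ennreal (W e / e * (d - e))"
        using I[OF e] We e ed by (intro add_mono) (auto simp: nn_integral_cmult_indicator simp flip: ennreal_mult)
      also have "\<dots> = ennreal (M * W e + W e / e * (d - e))"
        using We e \<delta> ed by simp
      also have "\<dots> \<le> ennreal ((M + 1 / e) * W d)"
      proof (rule ennreal_leI)
        have "M * W e \<le> M * W d"
          using \<delta> e ed by (intro mult_left_mono majorant_mono[OF W]) auto
        moreover have "W e / e * (d - e) \<le> W d / e * 1"
          using \<delta> e ed d We Wd by (intro mult_mono divide_right_mono majorant_mono[OF W]) auto
        ultimately show "M * W e + W e / e * (d - e) \<le> (M + 1 / e) * W d"
          by (simp add: algebra_simps)
      qed
      finally show ?thesis .
    qed
  qed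
qed

text \<open>
  For \<open>\<delta> \<le> d \<le> 1\<close> the tail from \<open>d\<close> is at most the tail from \<open>e = \<delta> / 2\<close>, which is at most a
  multiple of \<open>W(e) \<le> W(d) \<le> W(d) / d\<close>.
\<close>

lemma regular_majorant_integral_tail:
  assumes "regular_majorant W"
  obtains C where "0 < C"
    "\<And>d. 0 < d \<Longrightarrow> d \<le> 1 \<Longrightarrow> (\<integral>\<^sup>+t\<in>{d<..}. ennreal (W t / t\<^sup>2) \<partial>lborel) \<le> ennreal (C * W d / d)"
proof -
  obtain \<delta> M where \<delta>: "0 < \<delta>" "0 < M" and W: "majorant W"
    and I: "\<And>d. 0 < d \<Longrightarrow> d < \<delta> \<Longrightarrow>
      ennreal d * (\<integral>\<^sup>+t\<in>{d<..}. ennreal (W t / t\<^sup>2) \<partial>lborel) \<le> ennreal (M * W d)"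
    using assms unfolding regular_majorant_def by blast
  have I': "(\<integral>\<^sup>+t\<in>{d<..}. ennreal (W t / t\<^sup>2) \<partial>lborel) \<le> ennreal (M * W d / d)" if d: "0 < d" "d < \<delta>" for d
  proof -
    have "(\<integral>\<^sup>+t\<in>{d<..}. ennreal (W t / t\<^sup>2) \<partial>lborel)
        = ennreal (1 / d) * (ennreal d * (\<integral>\<^sup>+t\<in>{d<..}. ennreal (W t / t\<^sup>2) \<partial>lborel))"
      using d by (simp add: mult.assoc[symmetric] ennreal_mult[symmetric])
    also have "\<dots> \<le> ennreal (1 / d) * ennreal (M * W d)"
      by (intro mult_left_mono I d) simp
    also have "\<dots> = ennreal (M * W d / d)"
      using d by (subst ennreal_mult'[symmetric]) auto
    finally show ?thesis .
  qed
  define e where "e = \<delta> / 2"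
  have e: "0 < e" "e < \<delta>" using \<delta> by (auto simp: e_def)
  note We = majorant_nonneg[OF W, of e]
  show thesis
  proof (rule that)
    show "0 < M + M / e" using \<delta> e by (simp add: add_pos_pos)
    fix d :: real assume d: "0 < d" "d \<le> 1"
    note Wd = majorant_nonneg[OF W, of d]
    show "(\<integral>\<^sup>+t\<in>{d<..}. ennreal (W t / t\<^sup>2) \<partial>lborel) \<le> ennreal ((M + M / e) * W d / d)"
    proof (cases "d < \<delta>")
      case True
      show ?thesis
        using I'[OF d(1) True] by (rule order_trans)
          (use Wd d e \<delta> in \<open>auto intro!: ennreal_leI divide_right_mono mult_right_mono\<close>)
    next
      case False
      then have ed: "e \<le> d" using e by simp
      have "(\<integral>\<^sup>+t\<in>{d<..}. ennreal (W t / t\<^sup>2) \<partial>lborel) \<le> (\<integral>\<^sup>+t\<in>{e<..}. ennreal (W t / t\<^sup>2) \<partial>lborel)"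
        using ed by (intro nn_integral_mono) (auto simp: indicator_def)
      also have "\<dots> \<le> ennreal (M * W e / e)" by (rule I'[OF e])
      also have "\<dots> \<le> ennreal ((M + M / e) * W d / d)"
      proof (rule ennreal_leI)
        have "M * W e / e \<le> M / e * W d"
          using \<delta> e ed by (simp add: divide_right_mono mult_left_mono majorant_mono[OF W])
        also have "\<dots> \<le> (M + M / e) * W d"
          using \<delta> e d Wd by (intro mult_right_mono) auto
        also have "\<dots> \<le> (M + M / e) * W d / d"
          using \<delta> e d Wd by (simp add: le_divide_eq mult_left_le)
        finally show "M * W e / e \<le> (M + M / e) * W d / d" .
      qed
      finally show ?thesis .
    qed
  qed
qed

text \<open>
  Jordan's inequality, from the concavity of the sine.
\<close>

lemma sin_half_ge:
  assumes "0 \<le> \<tau>" "\<tau> \<le> 2 * pi"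
  shows "min \<tau> (2 * pi - \<tau>) / pi \<le> sin (\<tau> / 2)"
proof -
  have jordan: "t / pi \<le> sin (t / 2)" if "0 \<le> t" "t \<le> pi" for t
  proof -
    have "concave_on {0..pi} sin"
      by (rule f''_le0_imp_concave[where f' = cos and f'' = "\<lambda>x. - sin x"])
        (auto intro!: derivative_eq_intros sin_ge_zero)
    from concave_onD[OF this, of "t / pi" 0 "pi / 2"] that
    show ?thesis by simp
  qed
  show ?thesis
  proof (cases "\<tau> \<le> pi")
    case False
    have "sin ((2 * pi - \<tau>) / 2) = sin (\<tau> / 2)" by (simp add: diff_divide_distrib)
    then show ?thesis using jordan[of "2 * pi - \<tau>"] False assms by (simp add: min_def)
  qed (use assms jordan[of \<tau>] in \<open>simp add: min_def\<close>)
qed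

text \<open>
  The second bound holds since \<open>e\<^sup>i\<^sup>\<tau>\<close> is at distance \<open>2 sin (\<tau> / 2)\<close> from \<open>1\<close>, and the distance from \<open>r\<close>
  to \<open>1\<close> is already controlled by the first bound.
\<close>

lemma norm_cis_minus_real_ge:
  assumes r: "0 \<le> r" "r < 1" and \<tau>: "0 \<le> \<tau>" "\<tau> \<le> 2 * pi"
  shows "1 - r \<le> cmod (cis \<tau> - of_real r)" "min \<tau> (2 * pi - \<tau>) / pi \<le> cmod (cis \<tau> - of_real r)"
proof -
  show 1: "1 - r \<le> cmod (cis \<tau> - of_real r)"
    using norm_triangle_ineq2[of "cis \<tau>" "of_real r"] r by simp
  have "(cmod (cis \<tau> - 1))\<^sup>2 = (cos \<tau> - 1)\<^sup>2 + (sin \<tau>)\<^sup>2"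
    by (simp add: cmod_power2)
  also have "\<dots> = 2 - 2 * cos \<tau>"
    using sin_cos_squared_add[of \<tau>] by (simp add: power2_eq_square algebra_simps)
  also have "\<dots> = (2 * sin (\<tau> / 2))\<^sup>2"
    using cos_double_sin[of "\<tau> / 2"] by (simp add: power_mult_distrib)
  finally have "(cmod (cis \<tau> - 1))\<^sup>2 = (2 * sin (\<tau> / 2))\<^sup>2" .
  moreover have "0 \<le> sin (\<tau> / 2)" using \<tau> by (intro sin_ge_zero) auto
  ultimately have "2 * sin (\<tau> / 2) = cmod (cis \<tau> - 1)"
    using power2_eq_imp_eq[of "cmod (cis \<tau> - 1)" "2 * sin (\<tau> / 2)"] by simp
  also have "\<dots> \<le> cmod (cis \<tau> - of_real r) + cmod (of_real r - 1)"
    using norm_triangle_ineq[of "cis \<tau> - of_real r" "of_real r - 1"] by simp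
  also have "cmod (of_real r - 1) = 1 - r"
    using r by (metis abs_minus_commute abs_of_nonneg diff_ge_0_iff_ge less_imp_le norm_of_real of_real_1 of_real_diff)
  finally show "min \<tau> (2 * pi - \<tau>) / pi \<le> cmod (cis \<tau> - of_real r)"
    using 1 sin_half_ge[OF \<tau>] by linarith
qed

text \<open>
  With \<open>d = 1 - r\<close> the Poisson kernel at \<open>r\<close> is at most \<open>2 d / |e\<^sup>i\<^sup>\<tau> - r|\<^sup>2\<close>. As \<open>W(t) / t\<^sup>2\<close> is
  non-increasing and \<open>|e\<^sup>i\<^sup>\<tau> - r|\<close> is at least both \<open>d\<close> and a multiple of the distance of \<open>\<tau>\<close> from
  \<open>2\<pi>\<int>\<close>, the integral is at most a constant times \<open>d\<close> times
  \<open>\<integral>\<^sub>0\<^sup>d W(d) / d\<^sup>2 dt + \<integral>\<^sub>d\<^sup>\<infinity> W(t) / t\<^sup>2 dt\<close>, and the tail condition bounds this by \<open>O(W(d) / d)\<close>.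
\<close>

lemma regular_majorant_poisson_integral:
  assumes "regular_majorant W"
  obtains C where "0 < C" "\<And>r. 0 \<le> r \<Longrightarrow> r < 1 \<Longrightarrow>
    (\<integral>\<^sup>+\<tau>\<in>{0..2*pi}. ennreal (W (cmod (cis \<tau> - of_real r)) * ((1 - r\<^sup>2) / (cmod (cis \<tau> - of_real r))\<^sup>2)) \<partial>lborel)
      \<le> ennreal (C * W (1 - r))"
proof -
  have W: "majorant W" using assms by (simp add: regular_majorant_def)
  obtain C where C: "0 < C"
    and tail: "\<And>d. 0 < d \<Longrightarrow> d \<le> 1 \<Longrightarrow> (\<integral>\<^sup>+t\<in>{d<..}. ennreal (W t / t\<^sup>2) \<partial>lborel) \<le> ennreal (C * W d / d)"
    using regular_majorant_integral_tail[OF assms] by blast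
  show thesis
  proof (rule that)
    show "0 < 4 * pi * (1 + C)" using C by simp
    fix r :: real assume r: "0 \<le> r" "r < 1"
    define d where "d = 1 - r"
    have d: "0 < d" "d \<le> 1" using r by (auto simp: d_def)
    note Wd = majorant_nonneg[OF W, of d]
    \<comment> \<open>Truncation at \<open>d\<close> makes \<open>\<psi>\<close> non-increasing and bounded on \<open>[0, \<infinity>)\<close>.\<close>
    define \<psi> where "\<psi> t = W (max d t) / (max d t)\<^sup>2" for t
    have \<psi>0: "0 \<le> \<psi> t" for t using majorant_nonneg[OF W] d by (simp add: \<psi>_def)
    have "continuous_on UNIV \<psi>"
      unfolding \<psi>_def using d
      by (intro continuous_intros continuous_on_compose2[OF majorant_continuous[OF W]]) auto
    then have [measurable]: "\<psi> \<in> borel_measurable borel" by (rule borel_measurable_continuous_onI)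
    define J where "J = (\<integral>\<^sup>+t\<in>{0..}. ennreal (\<psi> t) \<partial>lborel)"
    have "J \<le> (\<integral>\<^sup>+t. ennreal (W d / d\<^sup>2) * indicator {0..d} t + ennreal (W t / t\<^sup>2) * indicator {d<..} t \<partial>lborel)"
      unfolding J_def by (intro nn_integral_mono) (auto simp: \<psi>_def indicator_def max_def)
    also have "\<dots> = (\<integral>\<^sup>+t. ennreal (W d / d\<^sup>2) * indicator {0..d} t \<partial>lborel) + (\<integral>\<^sup>+t\<in>{d<..}. ennreal (W t / t\<^sup>2) \<partial>lborel)"
    proof (rule nn_integral_add)
      have "(\<lambda>t. ennreal (\<psi> t) * indicator {d<..} t) \<in> borel_measurable lborel" by measurable
      then show "(\<lambda>t. ennreal (W t / t\<^sup>2) * indicator {d<..} t) \<in> borel_measurable lborel"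
        by (rule measurable_cong[THEN iffD1, rotated]) (auto simp: indicator_def \<psi>_def max_def)
    qed auto
    also have "\<dots> \<le> ennreal (W d / d) + ennreal (C * W d / d)"
      using d Wd by (intro add_mono tail)
        (auto simp: nn_integral_cmult_indicator power2_eq_square simp flip: ennreal_mult)
    also have "\<dots> = ennreal ((1 + C) * W d / d)"
      using d Wd C by (simp add: algebra_simps add_divide_distrib flip: ennreal_plus)
    finally have J: "J \<le> ennreal ((1 + C) * W d / d)" .
    define K where "K = (1 + C) * W d / d"
    have K: "0 \<le> K" using d Wd C by (simp add: K_def)
    have pi0: "\<not> pi \<le> 0" using pi_gt_zero by linarith
    have J1: "(\<integral>\<^sup>+\<tau>\<in>{0..2*pi}. ennreal (\<psi> (\<tau> / pi)) \<partial>lborel) \<le> ennreal pi * J"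
    proof -
      have "(\<integral>\<^sup>+\<tau>\<in>{0..2*pi}. ennreal (\<psi> (\<tau> / pi)) \<partial>lborel)
          = ennreal pi * (\<integral>\<^sup>+x. ennreal (\<psi> ((0 + pi * x) / pi)) * indicator {0..2*pi} (0 + pi * x) \<partial>lborel)"
        by (rule trans[OF nn_integral_real_affine[where c = pi and t = 0]]) simp_all
      also have "\<dots> \<le> ennreal pi * J"
        unfolding J_def by (intro mult_left_mono nn_integral_mono) (auto simp: indicator_def zero_le_mult_iff pi0)
      finally show ?thesis .
    qed
    have J2: "(\<integral>\<^sup>+\<tau>\<in>{0..2*pi}. ennreal (\<psi> ((2*pi - \<tau>) / pi)) \<partial>lborel) \<le> ennreal pi * J"
    proof -
      have "(\<integral>\<^sup>+\<tau>\<in>{0..2*pi}. ennreal (\<psi> ((2*pi - \<tau>) / pi)) \<partial>lborel)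
          = ennreal \<bar>- pi\<bar> * (\<integral>\<^sup>+x. ennreal (\<psi> ((2 * pi - (2 * pi + - pi * x)) / pi)) * indicator {0..2*pi} (2 * pi + - pi * x) \<partial>lborel)"
        by (rule trans[OF nn_integral_real_affine[where c = "-pi" and t = "2*pi"]]) simp_all
      also have "\<dots> \<le> ennreal pi * J"
        unfolding J_def by (simp, intro mult_left_mono nn_integral_mono) (auto simp: indicator_def zero_le_mult_iff pi0)
      finally show ?thesis .
    qed
    have pt: "W (cmod (cis \<tau> - of_real r)) * ((1 - r\<^sup>2) / (cmod (cis \<tau> - of_real r))\<^sup>2)
        \<le> 2 * d * (\<psi> (\<tau> / pi) + \<psi> ((2 * pi - \<tau>) / pi))" if \<tau>: "\<tau> \<in> {0..2*pi}" for \<tau>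
    proof -
      define c where "c = cmod (cis \<tau> - of_real r)"
      have c: "d \<le> c" "min \<tau> (2 * pi - \<tau>) / pi \<le> c"
        using norm_cis_minus_real_ge[OF r, of \<tau>] \<tau> by (auto simp: c_def d_def)
      have "W c / c\<^sup>2 \<le> \<psi> (min \<tau> (2 * pi - \<tau>) / pi)"
        unfolding \<psi>_def using c d by (intro majorant_ratio_power2[OF W]) auto
      also have "\<dots> \<le> \<psi> (\<tau> / pi) + \<psi> ((2 * pi - \<tau>) / pi)"
        using \<psi>0 by (simp add: min_def)
      finally have 1: "W c / c\<^sup>2 \<le> \<psi> (\<tau> / pi) + \<psi> ((2 * pi - \<tau>) / pi)" .
      have "1 - r\<^sup>2 = (1 + r) * d" by (simp add: d_def power2_eq_square algebra_simps)
      also have "\<dots> \<le> 2 * d" using r d by (intro mult_right_mono) auto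
      finally have 2: "1 - r\<^sup>2 \<le> 2 * d" .
      have "0 \<le> W c / c\<^sup>2" using majorant_nonneg[OF W, of c] c d by simp
      then have "(1 - r\<^sup>2) * (W c / c\<^sup>2) \<le> 2 * d * (\<psi> (\<tau> / pi) + \<psi> ((2 * pi - \<tau>) / pi))"
        using 1 2 d by (intro mult_mono) auto
      then show ?thesis by (simp add: c_def mult_ac)
    qed
    have "(\<integral>\<^sup>+\<tau>\<in>{0..2*pi}. ennreal (W (cmod (cis \<tau> - of_real r)) * ((1 - r\<^sup>2) / (cmod (cis \<tau> - of_real r))\<^sup>2)) \<partial>lborel)
      \<le> (\<integral>\<^sup>+\<tau>. ennreal (2 * d) * (ennreal (\<psi> (\<tau> / pi)) * indicator {0..2*pi} \<tau> +
            ennreal (\<psi> ((2 * pi - \<tau>) / pi)) * indicator {0..2*pi} \<tau>) \<partial>lborel)"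
      using \<psi>0 d pt by (intro nn_integral_mono) (auto simp: indicator_def ennreal_mult[symmetric] intro!: ennreal_leI simp flip: ennreal_plus)
    also have "\<dots> = ennreal (2 * d) * ((\<integral>\<^sup>+\<tau>\<in>{0..2*pi}. ennreal (\<psi> (\<tau> / pi)) \<partial>lborel) +
        (\<integral>\<^sup>+\<tau>\<in>{0..2*pi}. ennreal (\<psi> ((2*pi - \<tau>) / pi)) \<partial>lborel))"
      by (subst nn_integral_cmult, measurable, subst nn_integral_add, measurable)
    also have "\<dots> \<le> ennreal (2 * d) * (ennreal pi * ennreal K + ennreal pi * ennreal K)"
      unfolding K_def by (intro mult_left_mono add_mono order_trans[OF J1] order_trans[OF J2] J) auto
    also have "ennreal pi * ennreal K = ennreal (pi * K)"
      using K by (intro ennreal_mult[symmetric]) auto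
    also have "ennreal (pi * K) + ennreal (pi * K) = ennreal (pi * K + pi * K)"
      using K by (intro ennreal_plus[symmetric]) auto
    also have "ennreal (2 * d) * ennreal (pi * K + pi * K) = ennreal (2 * d * (pi * K + pi * K))"
      using K d by (intro ennreal_mult[symmetric]) auto
    also have "2 * d * (pi * K + pi * K) = 4 * pi * (1 + C) * W d"
      using d by (simp add: K_def field_simps)
    finally show "(\<integral>\<^sup>+\<tau>\<in>{0..2*pi}. ennreal (W (cmod (cis \<tau> - of_real r)) * ((1 - r\<^sup>2) / (cmod (cis \<tau> - of_real r))\<^sup>2)) \<partial>lborel)
        \<le> ennreal (4 * pi * (1 + C) * W (1 - r))" by (simp add: d_def)
  qed
qed

section \<open>From the Poisson variance to the modulus of continuity\<close>

lemma norm_ball_segment: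
  assumes "cmod w0 < 1" "cmod w1 < 1" "0 \<le> s" "s \<le> 1"
  shows "cmod (w0 + of_real s * (w1 - w0)) < 1"
proof -
  have "(1 - s) *\<^sub>R w0 + s *\<^sub>R w1 \<in> ball 0 1"
    using assms by (intro convexD[OF convex_ball]) auto
  then show ?thesis by (simp add: scaleR_conv_of_real algebra_simps)
qed

lemma continuous_on_deriv_comp:
  assumes "f \<in> disk_algebra" "continuous_on S g" "\<And>x. x \<in> S \<Longrightarrow> cmod (g x) < 1"
  shows "continuous_on S (\<lambda>x. deriv f (g x))"
proof (rule continuous_on_compose2[OF _ assms(2)])
  show "continuous_on (ball 0 1) (deriv f)"
    using assms(1) by (intro holomorphic_on_imp_continuous_on holomorphic_deriv) (auto simp: disk_algebra_iff)
qed (use assms(3) in auto)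

text \<open>
  Write the difference of the values of \<open>f\<close> as the integral of \<open>f'\<close> along the segment and apply
  Minkowski's inequality. The function \<open>\<rho>\<close> is any lower bound for the distance to the unit circle along the
  segment; it may degenerate at the ends, where \<open>b\<close> is then unbounded.
\<close>

lemma mean_le_along_segment:
  assumes f: "f \<in> disk_algebra" and p: "1 \<le> p" and \<omega>: "majorant \<omega>" and C: "0 \<le> C"
    and f': "\<And>w. cmod w < 1 \<Longrightarrow>
      mean_le p (\<lambda>\<eta>. cmod (deriv f (cis \<eta> * w))) (C * (\<omega> (1 - cmod w) / (1 - cmod w)))"
    and w: "cmod w0 < 1" "cmod w1 < 1" "cmod (w1 - w0) \<le> L"
    and \<rho>c: "continuous_on {0<..<1} \<rho>"
    and \<rho>: "\<And>s. 0 < s \<Longrightarrow> s < 1 \<Longrightarrow> 0 < \<rho> s \<and> \<rho> s \<le> 1 - cmod (w0 + of_real s * (w1 - w0))"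
    and B: "(\<integral>\<^sup>+s\<in>{0<..<1}. ennreal (C * L * (\<omega> (\<rho> s) / \<rho> s)) \<partial>lborel) \<le> ennreal B" "0 \<le> B"
  shows "mean_le p (\<lambda>\<eta>. cmod (f (cis \<eta> * w1) - f (cis \<eta> * w0))) B"
proof -
  define \<gamma> where "\<gamma> s = w0 + of_real s * (w1 - w0)" for s
  have \<gamma>: "cmod (\<gamma> s) < 1" if "0 \<le> s" "s \<le> 1" for s
    unfolding \<gamma>_def by (rule norm_ball_segment) fact+
  have L: "0 \<le> L" using w(3) norm_ge_zero order_trans by blast
  define h where "h s \<eta> = L * cmod (deriv f (cis \<eta> * \<gamma> s))" for s \<eta>
  define b where "b s = C * L * (\<omega> (\<rho> s) / \<rho> s)" for s
  show ?thesis
  proof (rule mean_le_Minkowski[where S = "{0<..<1}" and h = h and b = b, OF p])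
    show "continuous_on ({0<..<1} \<times> UNIV) (\<lambda>(s, \<eta>). h s \<eta>)"
      unfolding h_def split_beta
      by (intro continuous_intros continuous_on_deriv_comp f) (auto simp: \<gamma>_def norm_mult intro!: continuous_intros \<gamma>[unfolded \<gamma>_def])
    show "continuous_on {0<..<1} b"
      unfolding b_def using \<rho>
      by (intro continuous_intros \<rho>c continuous_on_compose2[OF majorant_continuous[OF \<omega>] \<rho>c])
        (force dest: less_imp_le)+
    show "0 \<le> h s \<eta>" for s \<eta> using L by (simp add: h_def)
    fix s :: real assume s: "s \<in> {0<..<1}"
    then have \<rho>s: "0 < \<rho> s" "\<rho> s \<le> 1 - cmod (\<gamma> s)" using \<rho>[of s] by (auto simp: \<gamma>_def)
    show "0 \<le> b s" using L C \<rho>s majorant_nonneg[OF \<omega>, of "\<rho> s"] by (simp add: b_def)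
    have "mean_le p (h s) (L * (C * (\<omega> (1 - cmod (\<gamma> s)) / (1 - cmod (\<gamma> s)))))"
      unfolding h_def
    proof (rule mean_le_cmult)
      show "mean_le p (\<lambda>\<eta>. cmod (deriv f (cis \<eta> * \<gamma> s))) (C * (\<omega> (1 - cmod (\<gamma> s)) / (1 - cmod (\<gamma> s))))"
        by (rule f') (use \<gamma>[of s] s in auto)
      show "0 \<le> C * (\<omega> (1 - cmod (\<gamma> s)) / (1 - cmod (\<gamma> s)))"
        using C \<rho>s majorant_nonneg[OF \<omega>, of "1 - cmod (\<gamma> s)"] by simp
      show "(\<lambda>\<eta>. cmod (deriv f (cis \<eta> * \<gamma> s))) \<in> borel_measurable borel"
        by (intro borel_measurable_continuous_onI continuous_intros continuous_on_deriv_comp f)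
          (use \<gamma>[of s] s in \<open>auto simp: norm_mult\<close>)
    qed (use L in auto)
    then show "mean_le p (h s) (b s)"
    proof (rule mean_le_mono)
      have "\<omega> (1 - cmod (\<gamma> s)) / (1 - cmod (\<gamma> s)) \<le> \<omega> (\<rho> s) / \<rho> s"
        by (rule majorant_ratio[OF \<omega> \<rho>s])
      then have "(L * C) * (\<omega> (1 - cmod (\<gamma> s)) / (1 - cmod (\<gamma> s))) \<le> (L * C) * (\<omega> (\<rho> s) / \<rho> s)"
        using L C by (intro mult_left_mono) auto
      then show "L * (C * (\<omega> (1 - cmod (\<gamma> s)) / (1 - cmod (\<gamma> s)))) \<le> b s"
        by (simp add: b_def mult_ac)
      show "0 \<le> L * (C * (\<omega> (1 - cmod (\<gamma> s)) / (1 - cmod (\<gamma> s))))"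
        using L C \<rho>s majorant_nonneg[OF \<omega>, of "1 - cmod (\<gamma> s)"] by simp
    qed (use L in \<open>auto simp: h_def\<close>)
  next
    fix \<eta> :: real
    define F where "F s = deriv f (cis \<eta> * \<gamma> s) * (cis \<eta> * (w1 - w0))" for s
    have "(F has_integral (f (cis \<eta> * \<gamma> 1) - f (cis \<eta> * \<gamma> 0))) {0..1}"
    proof (rule fundamental_theorem_of_calculus)
      fix s :: real assume s: "s \<in> {0..1}"
      have "(f has_field_derivative deriv f (cis \<eta> * \<gamma> s)) (at (cis \<eta> * \<gamma> s))"
        by (rule holomorphic_derivI[where S = "ball 0 1"])
          (use f \<gamma>[of s] s in \<open>auto simp: disk_algebra_iff norm_mult\<close>)
      moreover have "((\<lambda>s. cis \<eta> * \<gamma> s) has_vector_derivative cis \<eta> * (w1 - w0)) (at s within {0..1})"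
        unfolding \<gamma>_def by (auto intro!: derivative_eq_intros simp: algebra_simps)
      ultimately have "(f \<circ> (\<lambda>s. cis \<eta> * \<gamma> s) has_vector_derivative cis \<eta> * (w1 - w0) * deriv f (cis \<eta> * \<gamma> s)) (at s within {0..1})"
        by (intro field_vector_diff_chain_within) (auto intro: has_field_derivative_at_within)
      then show "((\<lambda>s. f (cis \<eta> * \<gamma> s)) has_vector_derivative F s) (at s within {0..1})"
        by (simp add: F_def o_def mult_ac)
    qed simp
    then have F: "(F has_integral (f (cis \<eta> * w1) - f (cis \<eta> * w0))) {0..1}"
      by (simp add: \<gamma>_def)
    have hi: "(\<lambda>s. h s \<eta>) integrable_on {0..1}"
      unfolding h_def
      by (intro integrable_continuous_real continuous_intros continuous_on_deriv_comp f)
        (auto simp: \<gamma>_def norm_mult intro!: continuous_intros \<gamma>[unfolded \<gamma>_def])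
    have "cmod (f (cis \<eta> * w1) - f (cis \<eta> * w0)) \<le> integral {0..1} (\<lambda>s. h s \<eta>)"
    proof -
      have "cmod (integral {0..1} F) \<le> integral {0..1} (\<lambda>s. h s \<eta>)"
        using F hi w(3) by (intro integral_norm_bound_integral)
          (auto simp: F_def h_def norm_mult mult.commute[of L] intro!: mult_left_mono)
      then show ?thesis using integral_unique[OF F] by simp
    qed
    moreover have "(\<integral>\<^sup>+s. ennreal (h s \<eta>) * indicator {0<..<1} s \<partial>lborel) = ennreal (integral {0..1} (\<lambda>s. h s \<eta>))"
      using integrable_integral[OF hi] L
      by (intro nn_integral_has_integral_lebesgue') (auto simp: h_def has_integral_Icc_iff_Ioo)
    ultimately show "ennreal (cmod (f (cis \<eta> * w1) - f (cis \<eta> * w0))) \<le> (\<integral>\<^sup>+s\<in>{0<..<1}. ennreal (h s \<eta>) \<partial>lborel)"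
      by (simp add: ennreal_leI)
  qed (use B in \<open>auto simp: b_def\<close>)
qed

text \<open>
  At time \<open>s\<close> the segment from \<open>z\<close> to \<open>(1 - d) z\<close> is at distance at least \<open>s d\<close> from the circle, and the
  substitution \<open>t = s d\<close> gives the integral of \<open>\<omega>(t) / t\<close>. The bound is uniform in \<open>z\<close>, so that \<open>z\<close> can
  later tend to the circle.
\<close>

lemma mean_le_radial:
  assumes f: "f \<in> disk_algebra" and p: "1 \<le> p" and \<omega>: "majorant \<omega>" and C: "0 \<le> C"
    and f': "\<And>w. cmod w < 1 \<Longrightarrow>
      mean_le p (\<lambda>\<eta>. cmod (deriv f (cis \<eta> * w))) (C * (\<omega> (1 - cmod w) / (1 - cmod w)))"
    and z: "cmod z < 1" and d: "0 < d" "d \<le> 1"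
    and I: "(\<integral>\<^sup>+t\<in>{0<..<d}. ennreal (\<omega> t / t) \<partial>lborel) \<le> ennreal (K * \<omega> d)" "0 \<le> K"
  shows "mean_le p (\<lambda>\<eta>. cmod (f (cis \<eta> * (of_real (1 - d) * z)) - f (cis \<eta> * z))) (C * K * \<omega> d)"
proof (rule mean_le_along_segment[OF f p \<omega> C f' z, where \<rho> = "\<lambda>s. s * d" and L = d])
  have zd: "cmod (of_real t * z) \<le> t" if "0 \<le> t" for t
    using that z by (simp add: norm_mult mult_left_le)
  show "cmod (of_real (1 - d) * z) < 1"
    using zd[of "1 - d"] d by linarith
  have "of_real (1 - d) * z - z = - (of_real d * z)" by (simp add: algebra_simps)
  then show "cmod (of_real (1 - d) * z - z) \<le> d"
    using zd[of d] d by simp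
  fix s :: real assume s: "0 < s" "s < 1"
  have "z + of_real s * (of_real (1 - d) * z - z) = of_real (1 - s * d) * z" by (simp add: algebra_simps)
  moreover have "s * d \<le> 1 * 1" using s d by (intro mult_mono) auto
  ultimately show "0 < s * d \<and> s * d \<le> 1 - cmod (z + of_real s * (of_real (1 - d) * z - z))"
    using zd[of "1 - s * d"] s d by simp
next
  have m: "(\<lambda>t. ennreal (\<omega> t / t) * indicator {0<..<d} t) \<in> borel_measurable borel"
  proof -
    have "(\<lambda>t. indicator {0<..<d} t *\<^sub>R (\<omega> t / t)) \<in> borel_measurable borel"
      by (intro borel_measurable_continuous_on_indicator continuous_intros
          continuous_on_subset[OF majorant_continuous[OF \<omega>]]) auto
    then have "(\<lambda>t. ennreal (indicator {0<..<d} t *\<^sub>R (\<omega> t / t))) \<in> borel_measurable borel" by simp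
    then show ?thesis by (rule measurable_cong[THEN iffD1, rotated]) (auto simp: indicator_def)
  qed
  then have m': "(\<lambda>s. ennreal (\<omega> (0 + d * s) / (0 + d * s)) * indicator {0<..<d} (0 + d * s)) \<in> borel_measurable lborel"
    by measurable
  have "(\<integral>\<^sup>+s\<in>{0<..<1}. ennreal (C * d * (\<omega> (s * d) / (s * d))) \<partial>lborel)
     = (\<integral>\<^sup>+s. ennreal (C * d) * (ennreal (\<omega> (0 + d * s) / (0 + d * s)) * indicator {0<..<d} (0 + d * s)) \<partial>lborel)"
  proof (rule nn_integral_cong)
    fix s :: real
    have iff: "d * s \<in> {0<..<d} \<longleftrightarrow> s \<in> {0<..<1}" using d by (auto simp: zero_less_mult_iff)
    show "ennreal (C * d * (\<omega> (s * d) / (s * d))) * indicator {0<..<1} s =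
        ennreal (C * d) * (ennreal (\<omega> (0 + d * s) / (0 + d * s)) * indicator {0<..<d} (0 + d * s))"
    proof (cases "s \<in> {0<..<1}")
      case True
      then show ?thesis
        using C d iff ennreal_mult'[of "C * d" "\<omega> (d * s) / (d * s)"] by (simp add: mult.commute[of s])
    next
      case False
      then have "d * s \<notin> {0<..<d}" using iff by blast
      then show ?thesis using False by (simp del: greaterThanLessThan_iff)
    qed
  qed
  also have "\<dots> = ennreal C * (ennreal \<bar>d\<bar> * (\<integral>\<^sup>+s. ennreal (\<omega> (0 + d * s) / (0 + d * s)) * indicator {0<..<d} (0 + d * s) \<partial>lborel))"
    using C d nn_integral_cmult[OF m', of "ennreal (C * d)"] by (simp add: ennreal_mult mult_ac)
  also have "ennreal \<bar>d\<bar> * (\<integral>\<^sup>+s. ennreal (\<omega> (0 + d * s) / (0 + d * s)) * indicator {0<..<d} (0 + d * s) \<partial>lborel)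
     = (\<integral>\<^sup>+t\<in>{0<..<d}. ennreal (\<omega> t / t) \<partial>lborel)"
    by (rule nn_integral_real_affine[OF m, symmetric]) (use d in simp)
  also have "ennreal C * \<dots> \<le> ennreal C * ennreal (K * \<omega> d)"
    by (intro mult_left_mono I) simp
  also have "\<dots> = ennreal (C * K * \<omega> d)"
    using C I d majorant_nonneg[OF \<omega>, of d] by (simp add: ennreal_mult mult_ac)
  finally show "(\<integral>\<^sup>+s\<in>{0<..<1}. ennreal (C * d * (\<omega> (s * d) / (s * d))) \<partial>lborel) \<le> ennreal (C * K * \<omega> d)" .
qed (use C I d majorant_nonneg[OF \<omega>, of d] in \<open>auto intro!: continuous_intros\<close>)

lemma mean_le_deriv_of_variance:
  assumes f: "f \<in> disk_algebra"
    and V: "mean_le p (\<lambda>\<eta>. sqrt (poisson_variance f (cis \<eta> * w))) (M * \<omega> (1 - cmod w))"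
    and w: "cmod w < 1" and M: "0 \<le> M" and \<omega>: "majorant \<omega>"
  shows "mean_le p (\<lambda>\<eta>. cmod (deriv f (cis \<eta> * w))) (M * (\<omega> (1 - cmod w) / (1 - cmod w)))"
proof -
  define d where "d = 1 - cmod w"
  have d: "0 < d" using w by (simp add: d_def)
  have M\<omega>: "0 \<le> M * \<omega> d" using M majorant_nonneg[OF \<omega>, of d] d by simp
  \<comment> \<open>Scaling by \<open>1 / d\<close> needs a measurable function, so the variance is first replaced by the
      continuous function \<open>d |f'|\<close>, which it dominates.\<close>
  have "mean_le p (\<lambda>\<eta>. d * cmod (deriv f (cis \<eta> * w))) (M * \<omega> d)"
  proof (rule mean_le_mono[OF V[folded d_def]])
    fix \<eta> :: real
    have w\<eta>: "cmod (cis \<eta> * w) = cmod w" by (simp add: norm_mult)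
    have "(cmod w)\<^sup>2 \<le> cmod w" using w by (simp add: power2_eq_square mult_left_le)
    then have "d * cmod (deriv f (cis \<eta> * w)) \<le> (1 - (cmod (cis \<eta> * w))\<^sup>2) * cmod (deriv f (cis \<eta> * w))"
      unfolding w\<eta> d_def by (intro mult_right_mono) auto
    also have "\<dots> \<le> sqrt (poisson_variance f (cis \<eta> * w))"
      by (rule norm_deriv_le_poisson_variance[OF f]) (simp add: w\<eta> w)
    finally show "0 \<le> d * cmod (deriv f (cis \<eta> * w)) \<and>
        d * cmod (deriv f (cis \<eta> * w)) \<le> sqrt (poisson_variance f (cis \<eta> * w))"
      using d by simp
  qed (use M\<omega> in auto)
  then have "mean_le p (\<lambda>\<eta>. 1 / d * (d * cmod (deriv f (cis \<eta> * w)))) (1 / d * (M * \<omega> d))"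
    using d M\<omega> w
    by (intro mean_le_cmult)
      (auto simp: norm_mult intro!: borel_measurable_continuous_onI continuous_intros continuous_on_deriv_comp f)
  then show ?thesis using d by (simp add: d_def[symmetric])
qed

text \<open>
  The three-segment path through \<open>(1 - d) z\<^sub>1\<close> and \<open>(1 - d) z\<^sub>2\<close>, where \<open>d = min 1 |z\<^sub>1 - z\<^sub>2|\<close>. For
  \<open>d = 1\<close> both intermediate points are \<open>0\<close>.
\<close>

lemma mean_le_difference_interior:
  assumes f: "f \<in> disk_algebra" and p: "1 \<le> p" and \<omega>: "majorant \<omega>" and C: "0 \<le> C"
    and f': "\<And>w. cmod w < 1 \<Longrightarrow>
      mean_le p (\<lambda>\<eta>. cmod (deriv f (cis \<eta> * w))) (C * (\<omega> (1 - cmod w) / (1 - cmod w)))"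
    and K: "0 \<le> K" "\<And>d. 0 < d \<Longrightarrow> d \<le> 1 \<Longrightarrow>
      (\<integral>\<^sup>+t\<in>{0<..<d}. ennreal (\<omega> t / t) \<partial>lborel) \<le> ennreal (K * \<omega> d)"
    and z: "cmod z1 < 1" "cmod z2 < 1"
  shows "mean_le p (\<lambda>\<eta>. cmod (f (cis \<eta> * z1) - f (cis \<eta> * z2))) (9 * (C * (K + 1)) * \<omega> (cmod (z1 - z2)))"
proof (cases "z1 = z2")
  case True
  then show ?thesis using \<omega> by (simp add: mean_le_def majorant_def)
next
  case False
  define d where "d = min 1 (cmod (z1 - z2))"
  have d: "0 < d" "d \<le> 1" "d \<le> cmod (z1 - z2)" using False by (auto simp: d_def)
  have \<omega>d: "0 \<le> \<omega> d" using majorant_nonneg[OF \<omega>] d by simp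
  define B where "B = C * (K + 1) * \<omega> d"
  have B: "0 \<le> B" using C K \<omega>d by (simp add: B_def)
  define w1 w2 where "w1 = of_real (1 - d) * z1" and "w2 = of_real (1 - d) * z2"
  have scaled: "cmod (of_real (1 - d) * z) \<le> 1 - d" if "cmod z < 1" for z
    using that d unfolding norm_mult norm_of_real by (simp add: mult_left_le)
  have w: "cmod w1 \<le> 1 - d" "cmod w2 \<le> 1 - d" using scaled z by (auto simp: w1_def w2_def)
  have radial: "mean_le p (\<lambda>\<eta>. cmod (f (cis \<eta> * (of_real (1 - d) * z)) - f (cis \<eta> * z))) B" if "cmod z < 1" for z
  proof (rule mean_le_mono[OF mean_le_radial[OF f p \<omega> C f' that d(1,2) K(2)[OF d(1,2)] K(1)]])
    have "C * K * \<omega> d \<le> C * (K + 1) * \<omega> d" using C \<omega>d by (intro mult_right_mono mult_left_mono) auto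
    then show "C * K * \<omega> d \<le> B" by (simp add: B_def)
    show "0 \<le> C * K * \<omega> d" using C K \<omega>d by simp
  qed auto
  have seg: "mean_le p (\<lambda>\<eta>. cmod (f (cis \<eta> * w1) - f (cis \<eta> * w2))) (C * \<omega> d)"
  proof (rule mean_le_along_segment[OF f p \<omega> C f', where \<rho> = "\<lambda>_. d" and L = d])
    have "w1 - w2 = of_real (1 - d) * (z1 - z2)" by (simp add: w1_def w2_def algebra_simps)
    then have "cmod (w1 - w2) = \<bar>1 - d\<bar> * cmod (z1 - z2)"
      by (simp only: norm_mult norm_of_real)
    also have "\<bar>1 - d\<bar> = 1 - d" using d by simp
    also have "(1 - d) * cmod (z1 - z2) \<le> d"
    proof (cases "cmod (z1 - z2) \<le> 1")
      case True
      then have "d = cmod (z1 - z2)" by (simp add: d_def)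
      then show ?thesis using d by (simp add: mult_left_le algebra_simps)
    qed (simp add: d_def)
    finally show "cmod (w1 - w2) \<le> d" .
    show "0 < d \<and> d \<le> 1 - cmod (w2 + of_real s * (w1 - w2))" if s: "0 < s" "s < 1" for s :: real
    proof -
      have "(1 - s) *\<^sub>R w2 + s *\<^sub>R w1 \<in> cball 0 (1 - d)"
        using s w by (intro convexD[OF convex_cball]) auto
      moreover have "(1 - s) *\<^sub>R w2 + s *\<^sub>R w1 = w2 + of_real s * (w1 - w2)"
        by (simp add: scaleR_conv_of_real algebra_simps)
      ultimately show ?thesis using d by simp
    qed
    show "(\<integral>\<^sup>+s\<in>{0<..<1::real}. ennreal (C * d * (\<omega> d / d)) \<partial>lborel) \<le> ennreal (C * \<omega> d)"
      using d by (subst nn_integral_cmult_indicator) auto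
  qed (use w d C \<omega>d in auto)
  have seg': "mean_le p (\<lambda>\<eta>. cmod (f (cis \<eta> * w1) - f (cis \<eta> * w2))) B"
  proof (rule mean_le_mono[OF seg])
    have "C * 1 * \<omega> d \<le> C * (K + 1) * \<omega> d" using C K \<omega>d by (intro mult_right_mono mult_left_mono) auto
    then show "C * \<omega> d \<le> B" by (simp add: B_def)
  qed (use C \<omega>d in auto)
  have fm: "(\<lambda>\<eta>. f (cis \<eta> * z)) \<in> borel_measurable borel" if "cmod z \<le> 1" for z
    using that f by (intro borel_measurable_continuous_onI disk_algebra_continuous_on_comp[OF f] continuous_intros)
      (auto simp: disk_algebra_iff norm_mult)
  note [measurable] = fm[of z1] fm[of z2] fm[of w1] fm[of w2]
  have "mean_le p (\<lambda>\<eta>. cmod (f (cis \<eta> * z1) - f (cis \<eta> * z2))) (9 * B)"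
  proof (rule mean_le_sum3[OF p _ _ _ _ _ _ radial[OF z(1), folded w1_def] seg' radial[OF z(2), folded w2_def] B])
    show "cmod (f (cis \<eta> * z1) - f (cis \<eta> * z2)) \<le> cmod (f (cis \<eta> * w1) - f (cis \<eta> * z1)) +
       cmod (f (cis \<eta> * w1) - f (cis \<eta> * w2)) + cmod (f (cis \<eta> * w2) - f (cis \<eta> * z2))" for \<eta>
      by norm
  qed (use w d z in auto)
  then show ?thesis
  proof (rule mean_le_mono)
    have "\<omega> d \<le> \<omega> (cmod (z1 - z2))" using d by (intro majorant_mono[OF \<omega>]) auto
    then have "9 * (C * (K + 1)) * \<omega> d \<le> 9 * (C * (K + 1)) * \<omega> (cmod (z1 - z2))"
      using C K by (intro mult_left_mono) auto
    then show "9 * B \<le> 9 * (C * (K + 1)) * \<omega> (cmod (z1 - z2))" by (simp add: B_def mult_ac)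
  qed (use B in auto)
qed

text \<open>
  Apply the estimate to \<open>r z\<^sub>1\<close> and \<open>r z\<^sub>2\<close>, whose distance is not larger, and let \<open>r\<close> tend to \<open>1\<close>.
\<close>

lemma mean_le_difference_closed:
  assumes f: "f \<in> disk_algebra" and p: "1 \<le> p" and \<omega>: "majorant \<omega>" and C: "0 \<le> C"
    and int: "\<And>z1 z2. cmod z1 < 1 \<Longrightarrow> cmod z2 < 1 \<Longrightarrow>
      mean_le p (\<lambda>\<eta>. cmod (f (cis \<eta> * z1) - f (cis \<eta> * z2))) (C * \<omega> (cmod (z1 - z2)))"
    and z: "cmod z1 \<le> 1" "cmod z2 \<le> 1"
  shows "mean_le p (\<lambda>\<eta>. cmod (f (cis \<eta> * z1) - f (cis \<eta> * z2))) (C * \<omega> (cmod (z1 - z2)))"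
proof -
  define r where "r n = 1 - 1 / real (Suc n)" for n
  have r: "0 \<le> r n" "r n < 1" for n by (auto simp: r_def)
  have rlim: "r \<longlonglongrightarrow> 1"
    unfolding r_def using tendsto_diff[OF tendsto_const LIMSEQ_Suc[OF lim_1_over_n], of "1::real"] by simp
  have rz: "cmod (of_real (r n) * z) < 1" if "cmod z \<le> 1" for n z
  proof -
    have "r n * cmod z \<le> r n * 1" using that r[of n] by (intro mult_left_mono) auto
    then show ?thesis using r[of n] by (simp add: norm_mult)
  qed
  have fc: "continuous_on (cball 0 1) f" using f by (simp add: disk_algebra_iff)
  have flim: "(\<lambda>n. f (cis \<eta> * (of_real (r n) * z))) \<longlonglongrightarrow> f (cis \<eta> * z)" if "cmod z \<le> 1" for \<eta> z
  proof (rule continuous_on_tendsto_compose[OF fc])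
    have "(\<lambda>n. cis \<eta> * (of_real (r n) * z)) \<longlonglongrightarrow> cis \<eta> * (of_real 1 * z)"
      by (intro tendsto_intros rlim)
    then show "(\<lambda>n. cis \<eta> * (of_real (r n) * z)) \<longlonglongrightarrow> cis \<eta> * z" by simp
    show "cis \<eta> * z \<in> cball 0 1" using that by (simp add: norm_mult)
    show "\<forall>\<^sub>F n in sequentially. cis \<eta> * (of_real (r n) * z) \<in> cball 0 1"
      using rz[OF that] by (intro always_eventually allI) (simp add: norm_mult less_imp_le)
  qed
  show ?thesis
  proof (rule mean_le_tendsto[OF p, where g = "\<lambda>n \<eta>. cmod (f (cis \<eta> * (of_real (r n) * z1)) - f (cis \<eta> * (of_real (r n) * z2)))"])
    fix n
    show "(\<lambda>\<eta>. cmod (f (cis \<eta> * (of_real (r n) * z1)) - f (cis \<eta> * (of_real (r n) * z2)))) \<in> borel_measurable borel"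
      by (intro borel_measurable_continuous_onI continuous_intros disk_algebra_continuous_on_comp[OF f])
        (use rz[OF z(1)] rz[OF z(2)] in \<open>auto simp: norm_mult less_imp_le\<close>)
    show "mean_le p (\<lambda>\<eta>. cmod (f (cis \<eta> * (of_real (r n) * z1)) - f (cis \<eta> * (of_real (r n) * z2)))) (C * \<omega> (cmod (z1 - z2)))"
    proof (rule mean_le_mono[OF int[OF rz[OF z(1)] rz[OF z(2)]]])
      have "of_real (r n) * z1 - of_real (r n) * z2 = of_real (r n) * (z1 - z2)" by (simp add: algebra_simps)
      then have "cmod (of_real (r n) * z1 - of_real (r n) * z2) = r n * cmod (z1 - z2)"
        using r[of n] by (simp add: norm_mult)
      also have "\<dots> \<le> cmod (z1 - z2)" using r[of n] by (simp add: mult_left_le_one_le)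
      finally show "C * \<omega> (cmod (of_real (r n) * z1 - of_real (r n) * z2)) \<le> C * \<omega> (cmod (z1 - z2))"
        using C by (intro mult_left_mono majorant_mono[OF \<omega>]) auto
      show "0 \<le> C * \<omega> (cmod (of_real (r n) * z1 - of_real (r n) * z2))"
        using C majorant_nonneg[OF \<omega>] by simp
    qed auto
  qed (auto intro!: tendsto_intros flim z)
qed

proposition mean_difference_if_mean_variance:
  assumes f: "f \<in> disk_algebra" and p: "1 \<le> p" and \<omega>: "regular_majorant \<omega>"
    and V: "\<exists>M>0. \<forall>z\<in>ball 0 1.
      mean_le p (\<lambda>\<eta>. sqrt (poisson_variance f (cis \<eta> * z))) (M * \<omega> (disk_dist z))"
  shows "\<exists>M>0. \<forall>z1\<in>cball 0 1. \<forall>z2\<in>cball 0 1.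
      mean_le p (\<lambda>\<eta>. cmod (f (cis \<eta> * z1) - f (cis \<eta> * z2))) (M * \<omega> (cmod (z1 - z2)))"
proof -
  have m: "majorant \<omega>" using \<omega> by (simp add: regular_majorant_def)
  obtain M where M: "0 < M" and V: "\<And>z. cmod z < 1 \<Longrightarrow>
      mean_le p (\<lambda>\<eta>. sqrt (poisson_variance f (cis \<eta> * z))) (M * \<omega> (1 - cmod z))"
    using V by (auto simp: disk_dist_def)
  obtain K where K: "0 < K" "\<And>d. 0 < d \<Longrightarrow> d \<le> 1 \<Longrightarrow>
      (\<integral>\<^sup>+t\<in>{0<..<d}. ennreal (\<omega> t / t) \<partial>lborel) \<le> ennreal (K * \<omega> d)"
    using regular_majorant_integral_near_0[OF \<omega>] by blast
  have f': "mean_le p (\<lambda>\<eta>. cmod (deriv f (cis \<eta> * w))) (M * (\<omega> (1 - cmod w) / (1 - cmod w)))"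
    if "cmod w < 1" for w
    using M by (intro mean_le_deriv_of_variance f V that m) auto
  have "mean_le p (\<lambda>\<eta>. cmod (f (cis \<eta> * z1) - f (cis \<eta> * z2))) (9 * (M * (K + 1)) * \<omega> (cmod (z1 - z2)))"
    if "cmod z1 \<le> 1" "cmod z2 \<le> 1" for z1 z2
  proof (rule mean_le_difference_closed[OF f p m _ _ that])
    show "mean_le p (\<lambda>\<eta>. cmod (f (cis \<eta> * w1) - f (cis \<eta> * w2))) (9 * (M * (K + 1)) * \<omega> (cmod (w1 - w2)))"
      if "cmod w1 < 1" "cmod w2 < 1" for w1 w2
      by (rule mean_le_difference_interior[OF f p m _ f' _ K(2) that]) (use M K in auto)
  qed (use M K in auto)
  moreover have "0 < 9 * (M * (K + 1))" using M K by (simp add: add_pos_pos)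
  ultimately show ?thesis by (intro exI[of _ "9 * (M * (K + 1))"]) auto
qed


section \<open>From the modulus of continuity to the Poisson variance\<close>

lemma unimodular_factor:
  obtains u :: complex where "cmod u = 1" "z = of_real (cmod z) * u"
proof (cases "z = 0")
  case True
  then show thesis using that[of 1] by simp
next
  case False
  then show thesis using that[of "z / of_real (cmod z)"] by (simp add: norm_divide)
qed

lemma continuous_on_double_rotation:
  assumes f: "f \<in> disk_algebra" and u: "cmod u \<le> 1"
  shows "continuous_on S (\<lambda>x. f (cis (snd x) * (cis (fst x) * u)))" "continuous_on S (\<lambda>x. f (cis (snd x) * u))"
  using u by (auto simp: norm_mult intro!: disk_algebra_continuous_on_comp[OF f] continuous_intros)

proposition mean_variance_if_mean_difference:
  assumes f: "f \<in> disk_algebra" and p: "2 \<le> p" and \<omega>: "majorant \<omega>" and \<omega>2: "regular_majorant (\<lambda>t. (\<omega> t)\<^sup>2)"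
    and F: "\<exists>M>0. \<forall>z1\<in>cball 0 1. \<forall>z2\<in>cball 0 1.
      mean_le p (\<lambda>\<eta>. cmod (f (cis \<eta> * z1) - f (cis \<eta> * z2))) (M * \<omega> (cmod (z1 - z2)))"
  shows "\<exists>M>0. \<forall>z\<in>ball 0 1.
      mean_le p (\<lambda>\<eta>. sqrt (poisson_variance f (cis \<eta> * z))) (M * \<omega> (disk_dist z))"
proof -
  obtain M where M: "0 < M" and F: "\<And>z1 z2. cmod z1 \<le> 1 \<Longrightarrow> cmod z2 \<le> 1 \<Longrightarrow>
      mean_le p (\<lambda>\<eta>. cmod (f (cis \<eta> * z1) - f (cis \<eta> * z2))) (M * \<omega> (cmod (z1 - z2)))"
    using F by auto
  obtain C where C: "0 < C" and CI: "\<And>r. 0 \<le> r \<Longrightarrow> r < 1 \<Longrightarrow>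
    (\<integral>\<^sup>+\<tau>\<in>{0..2*pi}. ennreal ((\<omega> (cmod (cis \<tau> - of_real r)))\<^sup>2 * ((1 - r\<^sup>2) / (cmod (cis \<tau> - of_real r))\<^sup>2)) \<partial>lborel)
      \<le> ennreal (C * (\<omega> (1 - r))\<^sup>2)"
    using regular_majorant_poisson_integral[OF \<omega>2] by blast
  have p2: "1 \<le> p / 2"
  proof -
    have "2 / 2 \<le> p / 2" using p by (rule divide_right_mono_ennreal)
    then show ?thesis by simp
  qed
  define K where "K = M * sqrt (C / (2 * pi))"
  have K: "0 < K" using M C by (simp add: K_def)
  have "mean_le p (\<lambda>\<eta>. sqrt (poisson_variance f (cis \<eta> * z))) (K * \<omega> (1 - cmod z))" if z: "cmod z < 1" for z
  proof -
    obtain u where u: "cmod u = 1" "z = of_real (cmod z) * u" by (rule unimodular_factor)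
    define r where "r = cmod z"
    have r: "0 \<le> r" "r < 1" using z by (auto simp: r_def)
    have zu: "z = of_real r * u" using u by (simp add: r_def)
    define P where "P \<tau> = poisson_kernel (of_real r) \<tau> / (2 * pi)" for \<tau>
    have Pc: "continuous_on S P" for S
      unfolding P_def using r by (intro continuous_intros continuous_on_poisson_kernel) auto
    have P0: "0 \<le> P \<tau>" for \<tau> unfolding P_def using poisson_kernel_pos[of "of_real r" \<tau>] r by simp
    define k where "k \<tau> \<eta> = cmod (f (cis \<eta> * (cis \<tau> * u)) - f (cis \<eta> * z))" for \<tau> \<eta>
    have kc: "continuous_on S (\<lambda>x. k (fst x) (snd x))" for S
      unfolding k_def using u z by (intro continuous_on_norm continuous_on_diff continuous_on_double_rotation f) auto
    have kc1: "continuous_on S (k \<tau>)" for S \<tau>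
      unfolding k_def using u z f
      by (intro continuous_intros disk_algebra_continuous_on_comp[OF f]) (auto simp: norm_mult disk_algebra_iff)
    have kc2: "continuous_on S (\<lambda>\<tau>. k \<tau> \<eta>)" for S \<eta>
      unfolding k_def using u z f
      by (intro continuous_intros disk_algebra_continuous_on_comp[OF f]) (auto simp: norm_mult disk_algebra_iff)
    have var: "poisson_variance f (cis \<eta> * z) = integral {0..2*pi} (\<lambda>\<tau>. P \<tau> * (k \<tau> \<eta>)\<^sup>2)" for \<eta>
    proof -
      have "poisson_variance f (of_real r * (u * cis \<eta>)) = integral {0..2*pi} (\<lambda>\<tau>. (cmod (f (cis \<tau> * (u * cis \<eta>)) - f (of_real r * (u * cis \<eta>))))\<^sup>2
          * poisson_kernel (of_real r) \<tau>) / (2 * pi)"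
        using u by (intro poisson_variance_rotate f r) (simp add: norm_mult)
      also have "\<dots> = integral {0..2*pi} (\<lambda>\<tau>. P \<tau> * (k \<tau> \<eta>)\<^sup>2)"
        by (subst Henstock_Kurzweil_Integration.integral_divide[symmetric])
          (simp add: P_def k_def zu mult_ac)
      finally show ?thesis by (simp add: zu mult_ac)
    qed
    have "mean_le (p / 2) (\<lambda>\<eta>. poisson_variance f (cis \<eta> * z)) ((K * \<omega> (1 - r))\<^sup>2)"
    proof (rule mean_le_Minkowski[OF p2, where S = "{0..2*pi}" and h = "\<lambda>\<tau> \<eta>. P \<tau> * (k \<tau> \<eta>)\<^sup>2"
          and b = "\<lambda>\<tau>. P \<tau> * (M * \<omega> (cmod (cis \<tau> * u - z)))\<^sup>2"])
      show "continuous_on ({0..2*pi} \<times> UNIV) (\<lambda>(\<tau>, \<eta>). P \<tau> * (k \<tau> \<eta>)\<^sup>2)"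
        unfolding split_beta
        by (intro continuous_intros kc continuous_on_compose2[OF Pc[of UNIV]]) auto
      show "continuous_on {0..2*pi} (\<lambda>\<tau>. P \<tau> * (M * \<omega> (cmod (cis \<tau> * u - z)))\<^sup>2)"
        by (intro continuous_intros Pc continuous_on_compose2[OF majorant_continuous[OF \<omega>]]) auto
      fix \<tau> :: real
      have "mean_le p (k \<tau>) (M * \<omega> (cmod (cis \<tau> * u - z)))"
        unfolding k_def using u z by (intro F) (auto simp: norm_mult)
      moreover have "0 \<le> M * \<omega> (cmod (cis \<tau> * u - z))" using M majorant_nonneg[OF \<omega>] by simp
      ultimately have "mean_le (p / 2) (\<lambda>\<eta>. (k \<tau> \<eta>)\<^sup>2) ((M * \<omega> (cmod (cis \<tau> * u - z)))\<^sup>2)"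
        by (subst mean_le_power2) (auto simp: k_def)
      then show "mean_le (p / 2) (\<lambda>\<eta>. P \<tau> * (k \<tau> \<eta>)\<^sup>2) (P \<tau> * (M * \<omega> (cmod (cis \<tau> * u - z)))\<^sup>2)"
        using P0[of \<tau>] by (intro mean_le_cmult borel_measurable_continuous_onI continuous_intros kc1) auto
    next
      have dist: "cmod (cis \<tau> * u - z) = cmod (cis \<tau> - of_real r)" for \<tau>
      proof -
        have "cis \<tau> * u - z = (cis \<tau> - of_real r) * u" by (simp add: zu algebra_simps)
        then show ?thesis using u by (simp add: norm_mult)
      qed
      have "(\<integral>\<^sup>+\<tau>\<in>{0..2*pi}. ennreal (P \<tau> * (M * \<omega> (cmod (cis \<tau> * u - z)))\<^sup>2) \<partial>lborel)
         = (\<integral>\<^sup>+\<tau>. ennreal (M\<^sup>2 / (2 * pi)) * (ennreal ((\<omega> (cmod (cis \<tau> - of_real r)))\<^sup>2 * ((1 - r\<^sup>2) / (cmod (cis \<tau> - of_real r))\<^sup>2)) * indicator {0..2*pi} \<tau>) \<partial>lborel)"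
      proof (rule nn_integral_cong)
        fix \<tau> :: real
        have eq: "P \<tau> * (M * \<omega> (cmod (cis \<tau> * u - z)))\<^sup>2 =
          M\<^sup>2 / (2 * pi) * ((\<omega> (cmod (cis \<tau> - of_real r)))\<^sup>2 * ((1 - r\<^sup>2) / (cmod (cis \<tau> - of_real r))\<^sup>2))"
          unfolding P_def poisson_kernel_def dist power_mult_distrib norm_of_real power2_abs
          by (simp only: divide_inverse mult_ac)
        have c0: "0 \<le> M\<^sup>2 / (2 * pi)" by simp
        show "ennreal (P \<tau> * (M * \<omega> (cmod (cis \<tau> * u - z)))\<^sup>2) * indicator {0..2*pi} \<tau> =
           ennreal (M\<^sup>2 / (2 * pi)) * (ennreal ((\<omega> (cmod (cis \<tau> - of_real r)))\<^sup>2 * ((1 - r\<^sup>2) / (cmod (cis \<tau> - of_real r))\<^sup>2)) * indicator {0..2*pi} \<tau>)"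
          unfolding eq by (subst ennreal_mult'[OF c0]) (rule mult.assoc)
      qed
      also have "\<dots> = ennreal (M\<^sup>2 / (2 * pi)) * (\<integral>\<^sup>+\<tau>\<in>{0..2*pi}. ennreal ((\<omega> (cmod (cis \<tau> - of_real r)))\<^sup>2 * ((1 - r\<^sup>2) / (cmod (cis \<tau> - of_real r))\<^sup>2)) \<partial>lborel)"
      proof (rule nn_integral_cmult)
        have "continuous_on UNIV (\<lambda>\<tau>. (\<omega> (cmod (cis \<tau> - of_real r)))\<^sup>2 * ((1 - r\<^sup>2) / (cmod (cis \<tau> - of_real r))\<^sup>2))"
          using cis_minus_nonzero[of "of_real r"] r
          by (intro continuous_intros continuous_on_compose2[OF majorant_continuous[OF \<omega>]]) auto
        from borel_measurable_continuous_onI[OF this]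
        show "(\<lambda>\<tau>. ennreal ((\<omega> (cmod (cis \<tau> - of_real r)))\<^sup>2 * ((1 - r\<^sup>2) / (cmod (cis \<tau> - of_real r))\<^sup>2)) * indicator {0..2*pi} \<tau>) \<in> borel_measurable lborel"
          by measurable
      qed
      also have "\<dots> \<le> ennreal (M\<^sup>2 / (2 * pi)) * ennreal (C * (\<omega> (1 - r))\<^sup>2)"
        by (intro mult_left_mono CI r) simp
      also have "\<dots> = ennreal ((K * \<omega> (1 - r))\<^sup>2)"
        using C by (subst ennreal_mult'[symmetric]) (auto simp: K_def power_mult_distrib)
      finally show "(\<integral>\<^sup>+\<tau>\<in>{0..2*pi}. ennreal (P \<tau> * (M * \<omega> (cmod (cis \<tau> * u - z)))\<^sup>2) \<partial>lborel) \<le> ennreal ((K * \<omega> (1 - r))\<^sup>2)" .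
    next
      fix \<eta> :: real
      have "((\<lambda>\<tau>. P \<tau> * (k \<tau> \<eta>)\<^sup>2) has_integral poisson_variance f (cis \<eta> * z)) {0..2*pi}"
        unfolding var by (intro integrable_integral integrable_continuous_real continuous_intros Pc kc2)
      then have "(\<integral>\<^sup>+\<tau>\<in>{0..2*pi}. ennreal (P \<tau> * (k \<tau> \<eta>)\<^sup>2) \<partial>lborel) = ennreal (poisson_variance f (cis \<eta> * z))"
        using P0 by (intro nn_integral_has_integral_lebesgue') auto
      then show "ennreal (poisson_variance f (cis \<eta> * z)) \<le> (\<integral>\<^sup>+\<tau>\<in>{0..2*pi}. ennreal (P \<tau> * (k \<tau> \<eta>)\<^sup>2) \<partial>lborel)"
        by simp
      show "0 \<le> poisson_variance f (cis \<eta> * z)"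
        using z by (intro poisson_variance_nonneg f) (simp add: norm_mult)
    qed (use P0 in auto)
    moreover have nn: "0 \<le> poisson_variance f (cis \<eta> * z)" for \<eta>
      using z by (intro poisson_variance_nonneg f) (simp add: norm_mult)
    moreover have "0 \<le> K * \<omega> (1 - r)" using K r majorant_nonneg[OF \<omega>] by simp
    ultimately show ?thesis
      using mean_le_power2[where p = p and g = "\<lambda>\<eta>. sqrt (poisson_variance f (cis \<eta> * z))" and C = "K * \<omega> (1 - r)"]
      by (simp add: r_def)
  qed
  then show ?thesis using K by (auto simp: disk_dist_def)
qed


section \<open>The equivalence\<close>

lemma Lambda_class_iff_mean_le:
  assumes f: "f \<in> disk_algebra" and p: "1 \<le> p" and \<omega>: "majorant \<omega>"
  shows "f \<in> Lambda_class \<omega> p \<longleftrightarrow> (\<exists>M>0. \<forall>z1\<in>cball 0 1. \<forall>z2\<in>cball 0 1.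
      mean_le p (\<lambda>\<eta>. cmod (f (cis \<eta> * z1) - f (cis \<eta> * z2))) (M * \<omega> (cmod (z1 - z2))))"
proof -
  have fm: "f \<in> borel_measurable (restrict_space borel (cball 0 1))"
    using f by (intro borel_measurable_continuous_on_restrict) (simp add: disk_algebra_iff)
  have "(\<forall>z1\<in>cball 0 1. \<forall>z2\<in>cball 0 1. int_mean_diff p f z1 z2 \<le> ennreal (M * \<omega> (cmod (z1 - z2)))) \<longleftrightarrow>
    (\<forall>z1\<in>cball 0 1. \<forall>z2\<in>cball 0 1. mean_le p (\<lambda>\<eta>. cmod (f (cis \<eta> * z1) - f (cis \<eta> * z2))) (M * \<omega> (cmod (z1 - z2))))"
    (is "?L \<longleftrightarrow> ?R") if M: "0 < M" for M
  proof -
    have M\<omega>: "0 \<le> M * \<omega> (cmod w)" for w using M majorant_nonneg[OF \<omega>] by simp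
    show ?thesis
    proof (cases "p = \<infinity>")
      case False
      then show ?thesis using int_mean_diff_le_iff[OF p False M\<omega>] by blast
    next
      case True
      have L: "?L \<longleftrightarrow> (\<forall>z1\<in>cball 0 1. \<forall>z2\<in>cball 0 1. cmod (f z1 - f z2) \<le> M * \<omega> (cmod (z1 - z2)))"
        using True M\<omega> by (simp add: int_mean_diff_def)
      show ?thesis unfolding L
      proof safe
        fix z1 z2 :: complex
        assume a: "\<forall>z1\<in>cball 0 1. \<forall>z2\<in>cball 0 1. cmod (f z1 - f z2) \<le> M * \<omega> (cmod (z1 - z2))"
          and z: "z1 \<in> cball 0 1" "z2 \<in> cball 0 1"
        have "cmod (f (cis \<eta> * z1) - f (cis \<eta> * z2)) \<le> M * \<omega> (cmod (z1 - z2))" for \<eta>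
        proof -
          have "cmod (f (cis \<eta> * z1) - f (cis \<eta> * z2)) \<le> M * \<omega> (cmod (cis \<eta> * z1 - cis \<eta> * z2))"
            using z by (intro a[rule_format]) (auto simp: norm_mult)
          also have "cis \<eta> * z1 - cis \<eta> * z2 = cis \<eta> * (z1 - z2)" by (simp add: algebra_simps)
          finally show ?thesis by (simp add: norm_mult)
        qed
        then show "mean_le p (\<lambda>\<eta>. cmod (f (cis \<eta> * z1) - f (cis \<eta> * z2))) (M * \<omega> (cmod (z1 - z2)))"
          using True by (simp add: mean_le_def)
      next
        fix z1 z2 :: complex
        assume a: ?R and z: "z1 \<in> cball 0 1" "z2 \<in> cball 0 1"
        then have "mean_le p (\<lambda>\<eta>. cmod (f (cis \<eta> * z1) - f (cis \<eta> * z2))) (M * \<omega> (cmod (z1 - z2)))" by blast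
        then have "cmod (f (cis 0 * z1) - f (cis 0 * z2)) \<le> M * \<omega> (cmod (z1 - z2))"
          using True unfolding mean_le_def by (auto dest!: bspec[of _ _ 0])
        then show "cmod (f z1 - f z2) \<le> M * \<omega> (cmod (z1 - z2))" by simp
      qed
    qed
  qed
  then show ?thesis unfolding Lambda_class_def using fm by blast
qed

lemma continuous_on_poisson_variance_circle:
  assumes f: "f \<in> disk_algebra" and z: "cmod z < 1"
  shows "continuous_on S (\<lambda>\<eta>. poisson_variance f (cis \<eta> * z))"
proof -
  obtain u where u: "cmod u = 1" "z = of_real (cmod z) * u" by (rule unimodular_factor)
  define r where "r = cmod z"
  have r: "0 \<le> r" "r < 1" and zu: "z = of_real r * u" using z u by (auto simp: r_def)
  have eq: "poisson_variance f (cis \<eta> * z) = integral (cbox 0 (2*pi)) (\<lambda>\<tau>. (cmod (f (cis \<eta> * (cis \<tau> * u)) - f (cis \<eta> * z)))\<^sup>2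
          * poisson_kernel (of_real r) \<tau>) / (2 * pi)" for \<eta>
    using poisson_variance_rotate[OF f r, of "u * cis \<eta>"] u by (simp add: norm_mult zu mult_ac)
  have "continuous_on (S \<times> cbox 0 (2*pi)) (\<lambda>(\<eta>, \<tau>). (cmod (f (cis \<eta> * (cis \<tau> * u)) - f (cis \<eta> * z)))\<^sup>2
          * poisson_kernel (of_real r) \<tau>)"
    unfolding split_beta using f u z r
    by (intro continuous_intros disk_algebra_continuous_on_comp[OF f] continuous_on_compose2[OF continuous_on_poisson_kernel[of _ UNIV]])
      (auto simp: norm_mult disk_algebra_iff)
  from integral_continuous_on_param[OF this]
  show ?thesis unfolding eq by (intro continuous_intros) auto
qed

text \<open>
  The variance is continuous along circles, so its Bochner integral is a genuine one and
  equals the extended integral that \<open>mean_le\<close> uses.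
\<close>

lemma mean_variance_le_iff:
  assumes f: "f \<in> disk_algebra" and p: "1 \<le> p" "p \<noteq> \<infinity>" and K: "0 \<le> K" and z: "cmod z < 1"
  shows "(LINT \<eta>:{0..2*pi}|lborel. poisson_variance f (z * cis \<eta>) powr (enn2real p / 2)) powr (1 / enn2real p) \<le> K
    \<longleftrightarrow> mean_le p (\<lambda>\<eta>. sqrt (poisson_variance f (cis \<eta> * z))) K"
proof -
  define q where "q = enn2real p"
  have q: "1 \<le> q" unfolding q_def using p by (intro enn2real_ge) auto
  define g where "g \<eta> = poisson_variance f (cis \<eta> * z) powr (q / 2)" for \<eta>
  have nn: "0 \<le> poisson_variance f (cis \<eta> * z)" for \<eta>
    using z by (intro poisson_variance_nonneg f) (simp add: norm_mult)
  have gc: "continuous_on {0..2*pi} g"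
    unfolding g_def using q nn
    by (intro continuous_on_powr' continuous_on_poisson_variance_circle f z continuous_intros) auto
  have I: "(LINT \<eta>:{0..2*pi}|lborel. g \<eta>) = integral {0..2*pi} g"
    by (rule set_borel_integral_eq_integral(2)[OF borel_integrable_atLeastAtMost'[OF gc]])
  have "(\<integral>\<^sup>+\<eta>\<in>{0..2*pi}. ennreal (g \<eta>) \<partial>lborel) = ennreal (integral {0..2*pi} g)"
    using gc by (intro nn_integral_has_integral_lebesgue' integrable_integral integrable_continuous_real) (auto simp: g_def)
  moreover have "sqrt (poisson_variance f (cis \<eta> * z)) powr q = g \<eta>" for \<eta>
    using nn[of \<eta>] by (simp add: g_def powr_half_sqrt[symmetric] powr_powr)
  ultimately have "mean_le p (\<lambda>\<eta>. sqrt (poisson_variance f (cis \<eta> * z))) K \<longleftrightarrow>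
      ennreal (integral {0..2*pi} g) \<le> ennreal (K powr q)"
    using p by (simp add: mean_le_def q_def)
  also have "\<dots> \<longleftrightarrow> integral {0..2*pi} g powr (1 / q) \<le> K"
  proof -
    have "0 \<le> integral {0..2*pi} g"
      using gc by (intro Henstock_Kurzweil_Integration.integral_nonneg integrable_continuous_real) (auto simp: g_def)
    then show ?thesis using q K by (simp add: powr_inverse_le_iff)
  qed
  finally show ?thesis using I by (simp add: q_def g_def mult.commute)
qed

text \<open>
  For \<open>p = \<infinity>\<close> the pointwise condition holds at every point of the disk, hence at all rotations of \<open>z\<close>,
  which have the same distance to the circle.
\<close>

lemma mean_variance_condition_iff:
  assumes f: "f \<in> disk_algebra" and p: "1 \<le> p" and \<omega>: "majorant \<omega>" and M: "0 < M"
  shows "(\<forall>z\<in>ball 0 1.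
       if p = \<infinity> then poisson_variance f z powr (1/2) \<le> M * \<omega> (disk_dist z)
       else (LINT \<eta>:{0..2*pi}|lborel. poisson_variance f (z * cis \<eta>) powr (enn2real p / 2)) powr (1 / enn2real p)
           \<le> M * \<omega> (disk_dist z)) \<longleftrightarrow>
    (\<forall>z\<in>ball 0 1. mean_le p (\<lambda>\<eta>. sqrt (poisson_variance f (cis \<eta> * z))) (M * \<omega> (disk_dist z)))"
    (is "?L \<longleftrightarrow> ?R")
proof (cases "p = \<infinity>")
  case False
  have "0 \<le> M * \<omega> (disk_dist z)" if "cmod z < 1" for z
    using that M majorant_nonneg[OF \<omega>] by (simp add: disk_dist_def)
  then show ?thesis using False by (simp add: mean_variance_le_iff[OF f p False])
next
  case True
  have L: "?L \<longleftrightarrow> (\<forall>z\<in>ball 0 1. sqrt (poisson_variance f z) \<le> M * \<omega> (disk_dist z))"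
    using True poisson_variance_nonneg[OF f] by (simp add: powr_half_sqrt)
  show ?thesis unfolding L
  proof safe
    fix z :: complex
    assume a: "\<forall>z\<in>ball 0 1. sqrt (poisson_variance f z) \<le> M * \<omega> (disk_dist z)" and z: "z \<in> ball 0 1"
    have "sqrt (poisson_variance f (cis \<eta> * z)) \<le> M * \<omega> (disk_dist z)" for \<eta>
    proof -
      have "sqrt (poisson_variance f (cis \<eta> * z)) \<le> M * \<omega> (disk_dist (cis \<eta> * z))"
        using z by (intro a[rule_format]) (auto simp: norm_mult)
      then show ?thesis by (simp add: disk_dist_def norm_mult)
    qed
    then show "mean_le p (\<lambda>\<eta>. sqrt (poisson_variance f (cis \<eta> * z))) (M * \<omega> (disk_dist z))"
      using True by (simp add: mean_le_def)
  next
    fix z :: complex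
    assume a: ?R and z: "z \<in> ball 0 1"
    then have "mean_le p (\<lambda>\<eta>. sqrt (poisson_variance f (cis \<eta> * z))) (M * \<omega> (disk_dist z))" by blast
    then have "sqrt (poisson_variance f (cis 0 * z)) \<le> M * \<omega> (disk_dist z)"
      using True unfolding mean_le_def by (auto dest!: bspec[of _ _ 0])
    then show "sqrt (poisson_variance f z) \<le> M * \<omega> (disk_dist z)" by simp
  qed
qed

theorem theorem2p10:
  fixes p :: ennreal and f :: "complex \<Rightarrow> complex" and \<omega> :: "real \<Rightarrow> real"
  assumes "2 \<le> p"
    and "f \<in> disk_algebra"
    and "regular_majorant \<omega>"
    and "regular_majorant (\<lambda>t. (\<omega> t)\<^sup>2)"
  shows "f \<in> Lambda_class \<omega> p \<longleftrightarrow>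
    (\<exists>M>0. \<forall>z\<in>ball 0 1.
       if p = \<infinity> then
         (poisson_integral (\<lambda>\<zeta>. (cmod (f \<zeta>))\<^sup>2) z - (cmod (f z))\<^sup>2) powr (1/2)
           \<le> M * \<omega> (disk_dist z)
       else
         (LINT \<eta>:{0..2*pi}|lborel.
            (poisson_integral (\<lambda>\<zeta>. (cmod (f \<zeta>))\<^sup>2) (z * cis \<eta>) - (cmod (f (z * cis \<eta>)))\<^sup>2)
              powr (enn2real p / 2)) powr (1 / enn2real p)
           \<le> M * \<omega> (disk_dist z))"
proof -
  have p: "1 \<le> p" using assms(1) by (rule order_trans[rotated]) simp
  have \<omega>: "majorant \<omega>" using assms(3) by (simp add: regular_majorant_def)
  have "f \<in> Lambda_class \<omega> p \<longleftrightarrow> (\<exists>M>0. \<forall>z\<in>ball 0 1.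
      mean_le p (\<lambda>\<eta>. sqrt (poisson_variance f (cis \<eta> * z))) (M * \<omega> (disk_dist z)))"
    unfolding Lambda_class_iff_mean_le[OF assms(2) p \<omega>]
    using mean_variance_if_mean_difference[OF assms(2,1) \<omega> assms(4)]
      mean_difference_if_mean_variance[OF assms(2) p assms(3)] by blast
  also have "\<dots> \<longleftrightarrow> (\<exists>M>0. \<forall>z\<in>ball 0 1.
       if p = \<infinity> then poisson_variance f z powr (1/2) \<le> M * \<omega> (disk_dist z)
       else (LINT \<eta>:{0..2*pi}|lborel. poisson_variance f (z * cis \<eta>) powr (enn2real p / 2)) powr (1 / enn2real p)
           \<le> M * \<omega> (disk_dist z))"
    using mean_variance_condition_iff[OF assms(2) p \<omega>] by blast
  finally show ?thesis unfolding poisson_variance_def .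
qed

end
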